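(* Let $G$ be a block graph that is $\mathcal{T}_3$-free, i.e. $G$ has no induced subgraph isomorphic to the graph $\mathcal{T}_3$. Then the $3$-independence complex $\mathrm{Ind}_3(G)$ is shellable.
   Context: All graphs are finite and simple. A block of a graph is a maximal connected subgraph that remains connected after removal of any single vertex; $G$ is a block graph if every block is a complete graph. The graph $\mathcal{T}_3$ has vertex set $\{x_1,\dots,x_9\}$ and edge set $\{x_1x_2, x_2x_3, x_3x_4, x_3x_5, x_4x_5, x_5x_6, x_6x_7, x_4x_8, x_8x_9\}$ (a triangle $x_3x_4x_5$ with a path of length two attached at each of its three vertices). For $r \geq 1$, a subset $A \subseteq V(G)$ is $r$-independent if every connected component of $G[A]$ has at most $r$ vertices; $\mathrm{Ind}_r(G)$ is the simplicial complex on $V(G)$ of all $r$-independent subsets. A (not necessarily pure) simplicial complex is shellable if its facets can be ordered $F_1,\dots,F_t$ so that for each $k>1$, $\langle F_k\rangle \cap \langle F_1,\dots,F_{k-1}\rangle$ is pure of dimension $\dim F_k-1$ ($\langle\mathcal F\rangle$ = complex generated by $\mathcal F$). *)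

theory Defs
  imports "Graph_Theory.Graph_Theory"
begin

text \<open>A finite simple graph is an element of the locale \<open>graph\<close>: a finite, loop-free digraph
  without parallel arcs whose arc relation is symmetric, so that every edge is a pair of opposite
  arcs. For such graphs the library's strongly connected components (\<open>sccs\<close>) are exactly the
  connected components.\<close>

section \<open>Block graphs\<close>

text \<open>The library's \<open>connected\<close> excludes the null graph. The clause \<open>verts H = {v}\<close> lets a
  single vertex survive the removal of its only vertex, so that an isolated vertex of \<open>G\<close> is a block.\<close>

definition nonseparable :: "('a, 'b) pre_digraph \<Rightarrow> bool" where
  "nonseparable H \<longleftrightarrow> graph H \<and> connected H \<and>
     (\<forall>v \<in> verts H. verts H = {v} \<or> connected (pre_digraph.del_vert H v))"

definition blocks :: "('a, 'b) pre_digraph \<Rightarrow> ('a, 'b) pre_digraph set" where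
  "blocks G = {B. pre_digraph.max_subgraph G nonseparable B}"

definition block_graph :: "('a, 'b) pre_digraph \<Rightarrow> bool" where
  "block_graph G \<longleftrightarrow> graph G \<and> (\<forall>B \<in> blocks G. complete_digraph (card (verts B)) B)"

section \<open>Forbidden induced subgraphs\<close>

definition induced_free :: "('c, 'd) pre_digraph \<Rightarrow> ('a, 'b) pre_digraph \<Rightarrow> bool" where
  "induced_free T G \<longleftrightarrow> \<not> (\<exists>H. induced_subgraph H G \<and> digraph_iso H T)"

text \<open>The vertex \<open>i\<close> stands for $x_i$.\<close>

definition T3_edges :: "(nat \<times> nat) set" where
  "T3_edges = {(1,2), (2,3), (3,4), (3,5), (4,5), (5,6), (6,7), (4,8), (8,9)}"

definition T3 :: "nat pair_pre_digraph" where
  "T3 = \<lparr> pverts = {1..9}, parcs = T3_edges \<union> T3_edges\<inverse> \<rparr>"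

lemma pair_graph_T3: "pair_graph T3"
  by unfold_locales (auto simp: T3_def T3_edges_def symmetric_def sym_def arcs_ends_def arc_to_ends_def)

section \<open>Shellability of simplicial complexes\<close>

text \<open>A simplicial complex is given by its set of faces, the empty face included.\<close>

definition simplicial_complex_on :: "'a set \<Rightarrow> 'a set set \<Rightarrow> bool" where
  "simplicial_complex_on V K \<longleftrightarrow> {} \<in> K \<and> (\<forall>A \<in> K. finite A \<and> A \<subseteq> V) \<and>
     (\<forall>A \<in> K. \<forall>B. B \<subseteq> A \<longrightarrow> B \<in> K)"

definition facets :: "'a set set \<Rightarrow> 'a set set" where
  "facets K = {F \<in> K. \<forall>A \<in> K. F \<subseteq> A \<longrightarrow> A = F}"

definition face_dim :: "'a set \<Rightarrow> int" where
  "face_dim F = int (card F) - 1"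

definition generated_complex :: "'a set set \<Rightarrow> 'a set set" where
  "generated_complex \<F> = {A. \<exists>F \<in> \<F>. A \<subseteq> F}"

definition pure_of_dim :: "int \<Rightarrow> 'a set set \<Rightarrow> bool" where
  "pure_of_dim d K \<longleftrightarrow> facets K \<noteq> {} \<and> (\<forall>F \<in> facets K. face_dim F = d)"

definition shellable :: "'a set set \<Rightarrow> bool" where
  "shellable K \<longleftrightarrow> (\<exists>Fs. distinct Fs \<and> set Fs = facets K \<and>
     (\<forall>k. 0 < k \<and> k < length Fs \<longrightarrow>
        pure_of_dim (face_dim (Fs ! k) - 1)
          (generated_complex {Fs ! k} \<inter> generated_complex (set (take k Fs)))))"

section \<open>Higher independence complexes\<close>

definition r_independent :: "nat \<Rightarrow> ('a, 'b) pre_digraph \<Rightarrow> 'a set \<Rightarrow> bool" where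
  "r_independent r G A \<longleftrightarrow> A \<subseteq> verts G \<and>
     (\<forall>C \<in> pre_digraph.sccs (G \<restriction> A). card (verts C) \<le> r)"

definition Ind :: "nat \<Rightarrow> ('a, 'b) pre_digraph \<Rightarrow> 'a set set" where
  "Ind r G = {A. r_independent r G A}"

lemma (in graph) simplicial_complex_on_Ind: "simplicial_complex_on (verts G) (Ind r G)"
proof -
  have mono: "B \<in> Ind r G" if A: "A \<in> Ind r G" and BA: "B \<subseteq> A" for A B
  proof -
    have AV: "A \<subseteq> verts G" and small: "\<And>C. C \<in> pre_digraph.sccs (G \<restriction> A) \<Longrightarrow> card (verts C) \<le> r"
      using A by (auto simp: Ind_def r_independent_def)
    have finA: "finite A" using AV finite_verts finite_subset by blast
    have "induced_subgraph (G \<restriction> A) G" using AV by (rule induced_induce)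
    then have "symmetric (G \<restriction> A)" using sym_arcs induced_graph_imp_symmetric by blast
    then interpret A: sym_digraph "G \<restriction> A"
      using wellformed_induce_subgraph by (simp add: sym_digraph_def sym_digraph_axioms_def)
    have "card (verts C) \<le> r" if C: "C \<in> pre_digraph.sccs (G \<restriction> B)" for C
    proof -
      have sc: "strongly_connected C" and iC: "induced_subgraph C (G \<restriction> B)"
        using C by (auto simp: pre_digraph.sccs_def)
      have sCB: "subgraph C (G \<restriction> B)" using iC by blast
      have "subgraph (G \<restriction> B) (G \<restriction> A)"
        using BA by (auto simp: subgraph_def compatible_def wellformed_induce_subgraph)
      then have sCA: "subgraph C (G \<restriction> A)" using sCB subgraph_trans by blast
      obtain u where u: "u \<in> verts C" using sc by (auto simp: strongly_connected_def)
      have uA: "u \<in> verts (G \<restriction> A)" using u sCA by (auto simp: subgraph_def)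
      let ?S = "{v. u \<rightarrow>\<^sup>*\<^bsub>G \<restriction> A\<^esub> v}"
      have sub: "verts C \<subseteq> ?S"
      proof
        fix v assume "v \<in> verts C"
        then have "u \<rightarrow>\<^sup>*\<^bsub>C\<^esub> v" using sc u by (auto simp: strongly_connected_def)
        then show "v \<in> ?S" using A.reachable_mono[OF _ sCA] by auto
      qed
      have "?S \<subseteq> A" using A.reachable_in_verts(2) by fastforce
      moreover have "card ?S \<le> r"
        using small[OF A.induce_reachable_is_in_sccs[OF uA]] by simp
      ultimately show ?thesis using sub finA by (meson card_mono finite_subset le_trans)
    qed
    then show ?thesis using BA AV by (auto simp: Ind_def r_independent_def)
  qed
  have "{} \<in> Ind r G"
    by (auto simp: Ind_def r_independent_def pre_digraph.sccs_def strongly_connected_def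
          induced_subgraph_def subgraph_def)
  moreover have "finite A \<and> A \<subseteq> verts G" if "A \<in> Ind r G" for A
    using that finite_subset[OF _ finite_verts] by (auto simp: Ind_def r_independent_def)
  ultimately show ?thesis using mono unfolding simplicial_complex_on_def by blast
qed

end

(* Call a vertex v an exchange vertex over a face X if, inside every face F above X missing v, the
   sets S with X <= S <= F that cannot be enlarged by v are closed under intersection. Then the facets
   above X are shelled by listing first those containing v and afterwards the others, grouped by their
   least subset that cannot be enlarged by v; induction from the facets downwards reduces
   shellability to finding an exchange vertex over every face X that is not a facet.

   In the subgraph induced by X and the vertices that can be added to X (the alive ones), a simplicial
   alive vertex is an exchange vertex. Otherwise root a component and choose a vertex p, lowest with
   an alive vertex strictly below it. In a block graph the alive vertices c below p are neighbours of p,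
   and each has a neighbour in X (its leaf) that is not adjacent to p. Either such a c is an
   exchange vertex, or p lies in a triangle with two alive vertices s, t that are not below p and whose
   neighbours in X are at most p. As s and t are not simplicial, a path of length two leaves the
   triangle at each of them; together with c and its leaf at p this is an induced T3. *)

theory Submission
  imports Defs
begin

section \<open>A shelling criterion\<close>

text \<open>The recursion passes only to larger faces and never deletes a vertex, so no hypothesis
  on deletions, as vertex decomposability would demand, has to be carried along. Closure under
  intersection is what gives every facet without v a single least obstruction; all facets above that
  obstruction then miss v as well. Because X lies in every face considered, a neighbour in X always
  occupies one of the at most three places of a component. Hence nearly every contradiction is a
  path on four vertices inside one face: two adjacent vertices, each with a further neighbour. The
  arms of the forbidden graph have length two for a related reason: the arm at p is an alive vertex
  with its neighbour in X, and at s and t non-simpliciality is used twice, the first vertex of the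
  arm being alive again.\<close>

definition rank_shelling :: "'a set set \<Rightarrow> 'a set \<Rightarrow> ('a set \<Rightarrow> nat) \<Rightarrow> bool" where
  "rank_shelling K X \<rho> \<longleftrightarrow> (\<forall>F \<in> facets K. \<forall>F' \<in> facets K.
     X \<subseteq> F \<and> X \<subseteq> F' \<and> F \<noteq> F' \<and> \<rho> F' \<le> \<rho> F \<longrightarrow>
       (\<exists>F'' \<in> facets K. \<rho> F'' < \<rho> F \<and> (\<exists>u \<in> F - F'. F - {u} \<subseteq> F'')))"

lemma rank_shellingE:
  assumes "rank_shelling K X \<rho>" "F \<in> facets K" "F' \<in> facets K" "X \<subseteq> F" "X \<subseteq> F'" "F \<noteq> F'" "\<rho> F' \<le> \<rho> F"
  obtains F'' u where "F'' \<in> facets K" "\<rho> F'' < \<rho> F" "u \<in> F - F'" "F - {u} \<subseteq> F''"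
proof -
  have "\<exists>F'' \<in> facets K. \<rho> F'' < \<rho> F \<and> (\<exists>u \<in> F - F'. F - {u} \<subseteq> F'')"
    using assms(1)[unfolded rank_shelling_def, rule_format, OF assms(2,3)] assms(4-7) by simp
  then show thesis by (elim bexE conjE) (rule that)
qed

definition exchange_vertex :: "'a set set \<Rightarrow> 'a set \<Rightarrow> 'a \<Rightarrow> bool" where
  "exchange_vertex K X v \<longleftrightarrow> v \<notin> X \<and> insert v X \<in> K \<and>
     (\<forall>F \<in> K. \<forall>S T. v \<notin> F \<and> X \<subseteq> S \<and> S \<subseteq> F \<and> X \<subseteq> T \<and> T \<subseteq> F \<and> insert v S \<notin> K \<and> insert v T \<notin> K
        \<longrightarrow> insert v (S \<inter> T) \<notin> K)"

lemma exchange_vertexD: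
  assumes "exchange_vertex K X v" "F \<in> K" "v \<notin> F" "X \<subseteq> S" "S \<subseteq> F" "X \<subseteq> T" "T \<subseteq> F"
    "insert v S \<notin> K" "insert v T \<notin> K"
  shows "insert v (S \<inter> T) \<notin> K"
proof -
  have "\<forall>F \<in> K. \<forall>S T. v \<notin> F \<and> X \<subseteq> S \<and> S \<subseteq> F \<and> X \<subseteq> T \<and> T \<subseteq> F \<and> insert v S \<notin> K \<and> insert v T \<notin> K
        \<longrightarrow> insert v (S \<inter> T) \<notin> K"
    using assms(1) unfolding exchange_vertex_def by (elim conjE)
  from bspec[OF this assms(2), THEN spec[of _ S], THEN spec[of _ T]] show ?thesis
    using assms(3-) by simp
qed

lemma facet_above:
  assumes "finite K" "A \<in> K"
  obtains F where "F \<in> facets K" "A \<subseteq> F"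
proof -
  obtain F where "F \<in> K" "A \<subseteq> F" "\<forall>B\<in>K. F \<subseteq> B \<longrightarrow> F = B"
    using finite_has_maximal2[OF assms] by blast
  then have "F \<in> facets K" unfolding facets_def by auto
  then show thesis using \<open>A \<subseteq> F\<close> by (rule that)
qed

lemma finite_complex:
  assumes "simplicial_complex_on V K" "finite V"
  shows "finite K"
proof -
  have "K \<subseteq> Pow V" using assms(1) unfolding simplicial_complex_on_def by blast
  then show ?thesis using assms(2) finite_subset by blast
qed

lemma shellable_if_rank_shellable:
  assumes K: "simplicial_complex_on V K" and V: "finite V"
    and R: "\<exists>\<rho>. rank_shelling K {} \<rho>"
  shows "shellable K"
proof -
  have finF: "finite (facets K)"
    using finite_complex[OF K V] unfolding facets_def by simp
  obtain \<rho> where \<rho>: "rank_shelling K {} \<rho>" using R ..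
  obtain Ls where Ls: "set Ls = facets K" "distinct Ls"
    using finite_distinct_list[OF finF] by blast
  \<comment> \<open>Ties in the rank may be broken arbitrarily: \<open>rank_shelling\<close> also
    compares facets of equal rank, and its \<open>F''\<close> has strictly smaller rank, so it
    stands earlier in every sorted list.\<close>
  define Fs where "Fs = sort_key \<rho> Ls"
  have Fs: "set Fs = facets K" "distinct Fs" "sorted (map \<rho> Fs)"
    using Ls by (simp_all add: Fs_def)
  have "pure_of_dim (face_dim (Fs ! k) - 1)
          (generated_complex {Fs ! k} \<inter> generated_complex (set (take k Fs)))"
    if k: "0 < k" "k < length Fs" for k
  proof -
    let ?F = "Fs ! k"
    let ?I = "generated_complex {?F} \<inter> generated_complex (set (take k Fs))"
    have FK: "?F \<in> facets K" using k Fs(1) nth_mem by blast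
    have finF: "finite ?F" using FK K unfolding facets_def simplicial_complex_on_def by blast
    \<comment> \<open>Each common face lies in a common face of codimension one. For a maximal
      \<open>A\<close> this forces \<open>A = ?F - {u}\<close>, which is purity.\<close>
    have ex: "\<exists>u\<in>?F. ?F - {u} \<in> ?I \<and> A \<subseteq> ?F - {u}" if A: "A \<in> ?I" for A
    proof -
      obtain G where G: "G \<in> set (take k Fs)" "A \<subseteq> G" "A \<subseteq> ?F"
        using A unfolding generated_complex_def by blast
      then obtain j where j: "j < k" "Fs ! j = G"
        using k by (auto simp: in_set_conv_nth)
      have GK: "G \<in> facets K" using j k Fs(1) nth_mem by force
      have ne: "?F \<noteq> G" using j k Fs(2) nth_eq_iff_index_eq by fastforce
      have le: "\<rho> G \<le> \<rho> ?F"
        using sorted_nth_mono[OF Fs(3), of j k] j k by simp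
      obtain F'' u where F'': "F'' \<in> facets K" "\<rho> F'' < \<rho> ?F" "u \<in> ?F - G" "?F - {u} \<subseteq> F''"
        using rank_shellingE[OF \<rho> FK GK _ _ ne le] by auto
      obtain i where i: "i < length Fs" "Fs ! i = F''"
        using F''(1) Fs(1) by (metis in_set_conv_nth)
      have "i < k"
      proof (rule ccontr)
        assume "\<not> i < k"
        then have "\<rho> ?F \<le> \<rho> F''" using sorted_nth_mono[OF Fs(3), of k i] i by simp
        then show False using F''(2) by simp
      qed
      then have "F'' \<in> set (take k Fs)" using i k by (auto simp: in_set_conv_nth)
      then have "?F - {u} \<in> ?I" using F''(4) unfolding generated_complex_def by blast
      then show ?thesis using F''(3) G by blast
    qed
    have "face_dim A = face_dim ?F - 1" if A: "A \<in> facets ?I" for A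
    proof -
      obtain u where "u \<in> ?F" "A = ?F - {u}"
        using ex[of A] A unfolding facets_def by blast
      then show ?thesis using finF card_Suc_Diff1[OF finF, of u] unfolding face_dim_def by simp
    qed
    moreover have "facets ?I \<noteq> {}"
    proof -
      have "finite ?I"
        using finF finite_subset[of ?I "Pow ?F"] unfolding generated_complex_def by blast
      moreover have "{} \<in> ?I"
      proof -
        have "Fs ! 0 \<in> set (take k Fs)" using k by (force simp: in_set_conv_nth)
        then show ?thesis unfolding generated_complex_def by blast
      qed
      ultimately obtain F where "F \<in> facets ?I" by (rule facet_above)
      then show ?thesis by blast
    qed
    ultimately show ?thesis unfolding pure_of_dim_def by blast
  qed
  then show ?thesis unfolding shellable_def using Fs by blast
qed

text \<open>Facets containing \<open>v\<close> come first, ranked by the rank function over \<open>insert v X\<close>; a facet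
  \<open>F\<close> without \<open>v\<close> is ranked over the least \<open>\<sigma> F \<subseteq> F\<close> that cannot be enlarged by \<open>v\<close>.\<close>

lemma rank_shellable_step:
  assumes K: "simplicial_complex_on V K" and V: "finite V"
    and v: "exchange_vertex K X v"
    and IH: "\<And>Y. Y \<in> K \<Longrightarrow> X \<subset> Y \<Longrightarrow> \<exists>\<rho>. rank_shelling K Y \<rho>"
  shows "\<exists>\<rho>. rank_shelling K X \<rho>"
proof -
  have down: "\<And>A B. A \<in> K \<Longrightarrow> B \<subseteq> A \<Longrightarrow> B \<in> K" and finK: "\<And>A. A \<in> K \<Longrightarrow> finite A"
    using K unfolding simplicial_complex_on_def by blast+
  have finF: "finite (facets K)"
    using finite_complex[OF K V] unfolding facets_def by simp
  have vX: "v \<notin> X" "insert v X \<in> K" using v unfolding exchange_vertex_def by blast+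
  obtain \<rho> where \<rho>: "\<And>Y. Y \<in> K \<Longrightarrow> X \<subset> Y \<Longrightarrow> rank_shelling K Y (\<rho> Y)"
  proof -
    have "\<forall>Y. \<exists>\<rho>. Y \<in> K \<and> X \<subset> Y \<longrightarrow> rank_shelling K Y \<rho>" using IH by simp
    then have "\<exists>\<rho>. \<forall>Y. Y \<in> K \<and> X \<subset> Y \<longrightarrow> rank_shelling K Y (\<rho> Y)" by (rule choice)
    then show thesis using that by blast
  qed
  define fam where "fam F = {S. X \<subseteq> S \<and> S \<subseteq> F \<and> insert v S \<notin> K}" for F
  define \<sigma> where "\<sigma> F = \<Inter>(fam F)" for F
  have \<sigma>: "\<sigma> F \<in> fam F" if F: "F \<in> facets K" "X \<subseteq> F" "v \<notin> F" for F
  proof -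
    have FK: "F \<in> K" using F(1) unfolding facets_def by blast
    have "insert v F \<notin> K" using F(1,3) unfolding facets_def by blast
    then have Ff: "F \<in> fam F" using F(2) unfolding fam_def by blast
    have fin: "finite (fam F)"
      using finite_subset[of "fam F" "Pow F"] finK[OF FK] unfolding fam_def by blast
    have int: "S \<inter> T \<in> fam F" if "S \<in> fam F" "T \<in> fam F" for S T
      using that exchange_vertexD[OF v FK F(3), of S T] unfolding fam_def by blast
    have "\<Inter>\<S> \<in> fam F" if "finite \<S>" "\<S> \<noteq> {}" "\<S> \<subseteq> fam F" for \<S>
      using that
    proof (induction rule: finite_ne_induct)
      case (insert S \<S>)
      then show ?case using int[of S "\<Inter>\<S>"] by simp
    qed simp
    then show ?thesis using fin Ff unfolding \<sigma>_def by blast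
  qed
  have \<sigma>_le: "\<sigma> F \<subseteq> S" if "S \<in> fam F" for F S using that unfolding \<sigma>_def by blast
  have \<sigma>K: "\<sigma> F \<in> K" "X \<subset> \<sigma> F" "\<sigma> F \<subseteq> F" if F: "F \<in> facets K" "X \<subseteq> F" "v \<notin> F" for F
  proof -
    have a: "X \<subseteq> \<sigma> F" "\<sigma> F \<subseteq> F" "insert v (\<sigma> F) \<notin> K" using \<sigma>[OF F] unfolding fam_def by blast+
    show "\<sigma> F \<subseteq> F" by fact
    show "\<sigma> F \<in> K" using down a(2) F(1) unfolding facets_def by blast
    show "X \<subset> \<sigma> F" using a vX by blast
  qed
  \<comment> \<open>A group is thus the set of all facets above some \<open>\<sigma> F\<close>, and
    the rank over \<open>\<sigma> F\<close> supplied by the induction hypothesis orders the whole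
    group.\<close>
  have \<sigma>_eq: "v \<notin> F' \<and> \<sigma> F' = \<sigma> F"
    if F: "F \<in> facets K" "X \<subseteq> F" "v \<notin> F" and F': "F' \<in> facets K" "\<sigma> F \<subseteq> F'" for F F'
  proof -
    have X': "X \<subseteq> F'" using \<sigma>K(2)[OF F] F'(2) by blast
    have nK: "insert v (\<sigma> F) \<notin> K" using \<sigma>[OF F] unfolding fam_def by blast
    have v': "v \<notin> F'"
    proof
      assume "v \<in> F'"
      then have "insert v (\<sigma> F) \<subseteq> F'" using F'(2) by blast
      then show False using nK down F'(1) unfolding facets_def by blast
    qed
    have "\<sigma> F \<in> fam F'" using F'(2) \<sigma>[OF F] unfolding fam_def by blast
    then have 1: "\<sigma> F' \<subseteq> \<sigma> F" by (rule \<sigma>_le)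
    then have "\<sigma> F' \<in> fam F" using \<sigma>[OF F'(1) X' v'] \<sigma>K(3)[OF F] unfolding fam_def by blast
    then have "\<sigma> F \<subseteq> \<sigma> F'" by (rule \<sigma>_le)
    with 1 v' show ?thesis by blast
  qed
  \<comment> \<open>The offset \<open>M\<close> exceeds every rank over \<open>insert v X\<close>.
    All groups share it and may interleave: facets of different groups are compared through a facet
    containing \<open>v\<close>.\<close>
  define M where "M = Suc (Max (\<rho> (insert v X) ` facets K))"
  have M: "\<rho> (insert v X) F < M" if "F \<in> facets K" for F
    unfolding M_def using finF that by (simp add: le_imp_less_Suc)
  define r where "r F = (if v \<in> F then \<rho> (insert v X) F else M + \<rho> (\<sigma> F) F)" for F
  have "\<exists>F'' \<in> facets K. r F'' < r F \<and> (\<exists>u \<in> F - F'. F - {u} \<subseteq> F'')"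
    if F: "F \<in> facets K" "X \<subseteq> F" and F': "F' \<in> facets K" "X \<subseteq> F'" and ne: "F \<noteq> F'" and le: "r F' \<le> r F"
    for F F'
  proof (cases "v \<in> F")
    case True
    have v': "v \<in> F'"
      using le M[OF F(1)] True unfolding r_def by (auto split: if_splits)
    obtain F'' u where F'': "F'' \<in> facets K" "\<rho> (insert v X) F'' < \<rho> (insert v X) F"
        "u \<in> F - F'" "F - {u} \<subseteq> F''"
      using rank_shellingE[OF \<rho>[of "insert v X"], of F F'] vX True v' F F' ne le unfolding r_def by auto
    have "v \<in> F''" using F''(3,4) v' True by blast
    then have "r F'' < r F" using F''(2) True unfolding r_def by simp
    then show ?thesis using F'' by blast
  next
    case False
    note FF = F False
    show ?thesis
    proof (cases "\<sigma> F \<subseteq> F'")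
      case True
      have e: "v \<notin> F'" "\<sigma> F' = \<sigma> F" using \<sigma>_eq[OF FF F'(1) True] by auto
      obtain F'' u where F'': "F'' \<in> facets K" "\<rho> (\<sigma> F) F'' < \<rho> (\<sigma> F) F"
          "u \<in> F - F'" "F - {u} \<subseteq> F''"
        using rank_shellingE[OF \<rho>[OF \<sigma>K(1,2)[OF FF]] F(1) F'(1) \<sigma>K(3)[OF FF] True ne] le e False
        unfolding r_def by auto
      \<comment> \<open>\<open>u\<close> is outside \<open>F'\<close>, hence outside
        \<open>\<sigma> F\<close>, so \<open>F''\<close> stays in the group of \<open>F\<close>,
        where both ranks come from the same function.\<close>
      have "\<sigma> F \<subseteq> F''" using F''(3,4) True \<sigma>K(3)[OF FF] by blast
      then have "v \<notin> F''" "\<sigma> F'' = \<sigma> F" using \<sigma>_eq[OF FF F''(1)] by auto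
      then have "r F'' < r F" using F''(2) False unfolding r_def by simp
      then show ?thesis using F'' by blast
    next
      case notsub: False
      then obtain u where u: "u \<in> \<sigma> F" "u \<notin> F'" by blast
      have uF: "u \<in> F" using u \<sigma>K(3)[OF FF] by blast
      \<comment> \<open>Without \<open>u\<close> the least obstruction is broken, so
        \<open>v\<close> can take the place of \<open>u\<close>; the resulting facet has rank below
        \<open>M\<close>.\<close>
      have "F - {u} \<notin> fam F" using \<sigma>_le[of "F - {u}" F] u by blast
      then have "insert v (F - {u}) \<in> K" using F(2) F'(2) u(2) unfolding fam_def by blast
      then obtain F'' where F'': "F'' \<in> facets K" "insert v (F - {u}) \<subseteq> F''"
        using facet_above[OF finite_complex[OF K V]] by blast
      have "r F'' < r F" using F'' M[OF F''(1)] False unfolding r_def by auto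
      then show ?thesis using F'' uF u(2) by blast
    qed
  qed
  then have "rank_shelling K X r" unfolding rank_shelling_def by blast
  then show ?thesis by (rule exI[of _ r])
qed

lemma shellable_if_exchange_vertices:
  assumes K: "simplicial_complex_on V K" and V: "finite V"
    and ex: "\<And>X. X \<in> K \<Longrightarrow> X \<notin> facets K \<Longrightarrow> \<exists>v. exchange_vertex K X v"
  shows "shellable K"
proof -
  have all: "\<exists>\<rho>. rank_shelling K X \<rho>" if "X \<in> K" for X
    using that
  proof (induction "card V - card X" arbitrary: X rule: less_induct)
    case less
    show ?case
    proof (cases "X \<in> facets K")
      case True
      have only: "F = X" if "F \<in> facets K" "X \<subseteq> F" for F
        using that True unfolding facets_def by blast
      have "rank_shelling K X (\<lambda>_. 0)"
        unfolding rank_shelling_def by (auto dest: only)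
      then show ?thesis by blast
    next
      case False
      then obtain v where v: "exchange_vertex K X v" using ex less.prems by blast
      show ?thesis
      proof (rule rank_shellable_step[OF K V v])
        fix Y assume Y: "Y \<in> K" "X \<subset> Y"
        have "Y \<subseteq> V" using Y K unfolding simplicial_complex_on_def by blast
        then have "card Y \<le> card V" "card X < card Y"
          using Y V by (auto intro: card_mono psubset_card_mono finite_subset)
        then show "\<exists>\<rho>. rank_shelling K Y \<rho>" using less.hyps[of Y] Y by simp
      qed
    qed
  qed
  have "{} \<in> K" using K unfolding simplicial_complex_on_def by (elim conjE)
  then have "\<exists>\<rho>. rank_shelling K {} \<rho>" by (rule all)
  then show ?thesis by (rule shellable_if_rank_shellable[OF K V])
qed

section \<open>Connectivity in block graphs\<close>

text \<open>The vertex set is a parameter, so that deleting a separator or growing a face only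
  changes \<open>U\<close>. The base case requires \<open>a \<in> U\<close>, so nothing is connected
  to a vertex outside \<open>U\<close>.\<close>

inductive conn :: "('a \<Rightarrow> 'a \<Rightarrow> bool) \<Rightarrow> 'a set \<Rightarrow> 'a \<Rightarrow> 'a \<Rightarrow> bool" for E U a where
  conn_refl: "a \<in> U \<Longrightarrow> conn E U a a"
| conn_step: "conn E U a b \<Longrightarrow> E b c \<Longrightarrow> c \<in> U \<Longrightarrow> conn E U a c"

definition small :: "('a \<Rightarrow> 'a \<Rightarrow> bool) \<Rightarrow> 'a set \<Rightarrow> bool" where
  "small E A \<longleftrightarrow> (\<forall>a \<in> A. card {b. conn E A a b} \<le> 3)"

lemma conn_in:
  assumes "conn E U a b"
  shows "a \<in> U" "b \<in> U"
  using assms by (induction) auto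

lemma conn_edge: "E a b \<Longrightarrow> a \<in> U \<Longrightarrow> b \<in> U \<Longrightarrow> conn E U a b"
  by (rule conn_step[OF conn_refl])

lemma conn_trans:
  assumes "conn E U a b" "conn E U b c"
  shows "conn E U a c"
  using assms(2,1) by (induction) (auto intro: conn_step)

lemma conn_mono:
  assumes "conn E U a b" "U \<subseteq> W"
  shows "conn E W a b"
  using assms by (induction) (auto intro: conn_refl conn_step)

lemma conn_sym:
  assumes E: "\<And>x y. E x y \<Longrightarrow> E y x" and ab: "conn E U a b"
  shows "conn E U b a"
  using ab
proof induction
  case (conn_step b c)
  then have "conn E U c b" using E conn_in conn_edge by metis
  then show ?case using conn_step.IH by (rule conn_trans)
qed (rule conn_refl)

text \<open>\<open>q\<close> is the vertex after the last visit to \<open>a\<close>: whenever the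
  walk returns to \<open>a\<close>, what came before is forgotten.\<close>

lemma conn_first_step:
  assumes "conn E U a b" "a \<noteq> b"
  obtains q where "E a q" "q \<in> U" "q \<noteq> a" "conn E (U - {a}) q b"
proof -
  have "b = a \<or> (\<exists>q. E a q \<and> q \<in> U \<and> q \<noteq> a \<and> conn E (U - {a}) q b)"
    using assms(1)
  proof induction
    case (conn_step b c)
    show ?case
    proof (cases "c = a")
      case False
      then have cU: "c \<in> U - {a}" using conn_step.hyps by simp
      show ?thesis
      proof (cases "b = a")
        case True
        then show ?thesis using conn_step.hyps(2) cU conn_refl[OF cU] by blast
      next
        case b: False
        then obtain q where q: "E a q" "q \<in> U" "q \<noteq> a" "conn E (U - {a}) q b"
          using conn_step.IH by blast
        have "conn E (U - {a}) q c" using q(4) conn_step.hyps(2) cU by (rule conn.conn_step)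
        then show ?thesis using q by blast
      qed
    qed simp
  qed simp
  then show thesis using assms(2) that by blast
qed

lemma finite_comp: "finite U \<Longrightarrow> finite {b. conn E U a b}"
  by (rule finite_subset[of _ U]) (auto dest: conn_in)

lemma small_subset:
  assumes "small E A" "B \<subseteq> A" "finite A"
  shows "small E B"
  unfolding small_def
proof
  fix a assume "a \<in> B"
  then have "card {b. conn E A a b} \<le> 3" using assms unfolding small_def by blast
  moreover have "card {b. conn E B a b} \<le> card {b. conn E A a b}"
    by (rule card_mono[OF finite_comp[OF assms(3)]]) (auto intro: conn_mono[OF _ assms(2)])
  ultimately show "card {b. conn E B a b} \<le> 3" by simp
qed

lemma four_connected_not_small:
  assumes "finite A" "conn E A a b" "conn E A a c" "conn E A a d" "distinct [a, b, c, d]"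
  shows "\<not> small E A"
proof -
  have "card (set [a, b, c, d]) \<le> card {x. conn E A a x}"
    using assms conn_refl[of a A E] conn_in(1)[OF assms(2)]
    by (intro card_mono finite_comp) auto
  moreover have "card (set [a, b, c, d]) = 4" using assms(5) by (subst distinct_card) simp_all
  ultimately show ?thesis using conn_in(1)[OF assms(2)] unfolding small_def by fastforce
qed

text \<open>A component of \<open>insert v S\<close> that avoids \<open>v\<close> is connected
  within \<open>S\<close> already, so only the component of \<open>v\<close> can be too
  large.\<close>

lemma not_small_insert:
  assumes E: "\<And>x y. E x y \<Longrightarrow> E y x" and S: "finite S" "small E S" and "\<not> small E (insert v S)"
  shows "card {b. conn E (insert v S) v b} > 3"
proof -
  obtain a where a: "a \<in> insert v S" "card {b. conn E (insert v S) a b} > 3"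
    using assms(4) unfolding small_def by (auto simp: not_le)
  have av: "conn E (insert v S) a v"
  proof (rule ccontr)
    assume n: "\<not> conn E (insert v S) a v"
    then have aS: "a \<in> S" using a(1) conn_refl[of v "insert v S" E] by blast
    have "conn E S a b" if "conn E (insert v S) a b" for b
      using that
    proof induction
      case (conn_step b c)
      then have "conn E (insert v S) a c" by (blast intro: conn.conn_step)
      then have "c \<noteq> v" using n by blast
      then show ?case using conn_step by (blast intro: conn.conn_step)
    qed (rule conn_refl[OF aS])
    then have "card {b. conn E (insert v S) a b} \<le> card {b. conn E S a b}"
      by (intro card_mono finite_comp S) blast
    then show False using a S(2) aS unfolding small_def by fastforce
  qed
  have "{b. conn E (insert v S) a b} = {b. conn E (insert v S) v b}"
    using conn_trans[OF av] conn_trans[OF conn_sym[OF E av]] by blast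
  then show ?thesis using a(2) by simp
qed

text \<open>Pigeonhole. With \<open>M\<close> consisting of three known vertices, a component of
  more than three yields a fourth vertex attached to one of them.\<close>

lemma comp_leaves_set:
  assumes "card {b. conn E U a b} > card M" "finite M" "a \<in> M"
  obtains m u where "m \<in> M" "u \<in> U" "u \<notin> M" "E m u" "conn E U a m"
proof -
  have "\<exists>m u. m \<in> M \<and> u \<in> U \<and> u \<notin> M \<and> E m u \<and> conn E U a m"
  proof (rule ccontr)
    assume n: "\<not> ?thesis"
    have "b \<in> M" if "conn E U a b" for b
      using that
    proof induction
      case (conn_step b c)
      then show ?case using n by blast
    qed (rule assms(3))
    then have "card {b. conn E U a b} \<le> card M" by (intro card_mono assms(2)) blast
    then show False using assms(1) by simp
  qed
  then show thesis using that by blast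
qed

text \<open>\<open>block\<close> expresses the block condition without blocks: two neighbours of
  \<open>v\<close> joined by a path that avoids \<open>v\<close> lie on a cycle with
  \<open>v\<close>, hence in a common complete block. As \<open>conn\<close> is monotone in the
  vertex set, the condition passes to every smaller \<open>V\<close>.\<close>

locale block_rel =
  fixes E :: "'a \<Rightarrow> 'a \<Rightarrow> bool" and V :: "'a set"
  assumes fin: "finite V"
    and sym: "E a b \<Longrightarrow> E b a"
    and irr: "\<not> E a a"
    and block: "\<lbrakk>v \<in> V; E v a; E v b; a \<noteq> b; conn E (V - {v}) a b\<rbrakk> \<Longrightarrow> E a b"
begin

lemma cs: "conn E U a b \<Longrightarrow> conn E U b a"
  by (rule conn_sym[OF sym])

text \<open>The path \<open>a\<close>, \<open>w\<close>, \<open>b\<close> avoids \<open>v\<close>,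
  so \<open>block\<close> applies at \<open>v\<close>. There is thus neither an induced four-cycle
  nor an induced diamond.\<close>

lemma diamond:
  assumes "E v a" "E v b" "E w a" "E w b" "a \<noteq> b" "w \<noteq> v" "v \<in> V" "w \<in> V" "a \<in> V" "b \<in> V"
  shows "E a b"
proof (rule block)
  have "a \<noteq> v" "b \<noteq> v" using assms(1,2) irr by blast+
  then have "conn E (V - {v}) a w" "conn E (V - {v}) w b"
    using assms by (auto intro!: conn_edge sym)
  then show "conn E (V - {v}) a b" by (rule conn_trans)
qed (use assms in auto)

lemma separator:
  assumes "conn E U a b" "U \<subseteq> V" "a \<noteq> b" "\<not> E a b"
  obtains q where "q \<in> U" "q \<noteq> a" "q \<noteq> b" "\<not> conn E (V - {q}) a b"
proof -
  have "U \<subseteq> U \<and> conn E U a b" using assms(1) by simp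
  from ex_has_least_nat[of "\<lambda>W. W \<subseteq> U \<and> conn E W a b", OF this, of card]
  obtain W where W: "W \<subseteq> U" "conn E W a b"
      and min: "\<forall>W'. W' \<subseteq> U \<and> conn E W' a b \<longrightarrow> card W \<le> card W'"
    by (elim exE conjE)
  have finW: "finite W" by (rule finite_subset[OF _ fin]) (use W(1) assms(2) in blast)
  obtain q where q: "E a q" "q \<in> W" "q \<noteq> a" "conn E (W - {a}) q b"
    using conn_first_step[OF W(2) assms(3)] by blast
  have qb: "q \<noteq> b" using q(1) assms(4) by blast
  obtain q' where q': "E q q'" "q' \<in> W - {a}" "q' \<noteq> q" "conn E (W - {a} - {q}) q' b"
    using conn_first_step[OF q(4) qb] by blast
  have aV: "a \<in> W" "W \<subseteq> V" using conn_in(1)[OF W(2)] W(1) assms(2) by auto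
  have "\<not> conn E (V - {q}) a b"
  proof
    assume ab: "conn E (V - {q}) a b"
    have "conn E (V - {q}) q' b" by (rule conn_mono[OF q'(4)]) (use aV in blast)
    then have "conn E (V - {q}) a q'" using conn_trans[OF ab cs] by blast
    then have "E a q'" using block[of q a q'] q q' sym aV by blast
    then have "conn E (W - {q}) a q'" using aV q(3) q'(2,3) by (intro conn_edge) auto
    moreover have "conn E (W - {q}) q' b" by (rule conn_mono[OF q'(4)]) blast
    ultimately have "conn E (W - {q}) a b" by (rule conn_trans)
    then have "card W \<le> card (W - {q})" using W(1) min[THEN spec[of _ "W - {q}"]] by auto
    then show False using card_Diff1_less[OF finW q(2)] by simp
  qed
  then show thesis using that q(2,3) qb W(1) by blast
qed

text \<open>By \<open>block\<close> at \<open>x\<close>, the vertex \<open>a\<close> is cut off from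
  its non-neighbour \<open>y\<close> by \<open>x\<close>, and \<open>a'\<close> is on the side of
  \<open>a\<close>. So everything that \<open>y\<close> reaches without \<open>x\<close> is distinct
  from and non-adjacent to the arm \<open>a\<close>, \<open>a'\<close>.\<close>

lemma branch_separated:
  assumes V: "x \<in> V" "a \<in> V" "a' \<in> V"
    and "E x y" "E x a" "a \<noteq> y" "\<not> E a y" "E a a'" "a' \<noteq> x"
    and w: "conn E (V - {x}) y w"
  shows "w \<noteq> a" "w \<noteq> a'" "\<not> E w a" "\<not> E w a'" "\<not> E a w" "\<not> E a' w"
proof -
  have ax: "a \<noteq> x" using assms(5) irr by blast
  have n: "\<not> conn E (V - {x}) y a"
  proof
    assume "conn E (V - {x}) y a"
    then have "E y a" using block[OF V(1) assms(4,5)] assms(6) by simp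
    then show False using sym assms(7) by blast
  qed
  have n': "\<not> conn E (V - {x}) y a'"
  proof
    assume "conn E (V - {x}) y a'"
    then have "conn E (V - {x}) y a"
      by (rule conn_step) (use sym[OF assms(8)] V ax in auto)
    then show False using n by blast
  qed
  show "w \<noteq> a" "w \<noteq> a'" using w n n' by blast+
  show "\<not> E w a"
  proof
    assume "E w a"
    with w have "conn E (V - {x}) y a" by (rule conn_step) (use V ax in auto)
    then show False using n by blast
  qed
  then show "\<not> E a w" using sym by blast
  show "\<not> E w a'"
  proof
    assume "E w a'"
    with w have "conn E (V - {x}) y a'" by (rule conn_step) (use V assms(9) in auto)
    then show False using n' by blast
  qed
  then show "\<not> E a' w" using sym by blast
qed

text \<open>The hypotheses on each arm are local. The remaining non-edges and inequalities between
  different parts come from the triangle vertices, each of which separates its arm from the six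
  vertices outside that arm and its foot.\<close>

lemma induced_T3:
  assumes V: "x \<in> V" "y \<in> V" "z \<in> V" "a \<in> V" "a' \<in> V" "b \<in> V" "b' \<in> V" "c \<in> V" "c' \<in> V"
    and tri: "E x y" "E y z" "E x z"
    and A: "E x a" "a \<noteq> y" "\<not> E a y" "E a a'" "\<not> E a' x" "a' \<noteq> x"
    and B: "E y b" "b \<noteq> x" "\<not> E b x" "E b b'" "\<not> E b' y" "b' \<noteq> y"
    and C: "E z c" "c \<noteq> x" "\<not> E c x" "E c c'" "\<not> E c' z" "c' \<noteq> z"
  shows "\<exists>f :: nat \<Rightarrow> 'a. inj_on f {1..9} \<and> f ` {1..9} \<subseteq> V \<and>
     (\<forall>i \<in> {1..9}. \<forall>j \<in> {1..9}. E (f i) (f j) \<longleftrightarrow> (i, j) \<in> T3_edges \<union> T3_edges\<inverse>)"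
proof -
  have tri': "E y x" "E z y" "E z x" using tri sym by blast+
  have ne: "x \<noteq> y" "y \<noteq> z" "x \<noteq> z" using tri irr by blast+
  have az: "a \<noteq> z" using A(3) tri'(2) by blast
  have bz: "b \<noteq> z" using B(3) tri'(3) by blast
  have cy: "c \<noteq> y" using C(3) tri'(1) by blast
  have ne2: "a' \<noteq> y" "a' \<noteq> z" "b' \<noteq> x" "b' \<noteq> z" "c' \<noteq> x" "c' \<noteq> y"
    using A(5) B(5) C(5) tri tri' by blast+
  have self: "a \<noteq> x" "b \<noteq> y" "c \<noteq> z" using A(1) B(1) C(1) irr by blast+
  let ?X = "conn E (V - {x}) y"
  have X1: "?X y" using V ne by (intro conn_refl) auto
  have X2: "?X z" by (rule conn_step[OF X1]) (use V ne tri in auto)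
  have X3: "?X b" by (rule conn_step[OF X1]) (use V B in auto)
  have X4: "?X b'" by (rule conn_step[OF X3]) (use V B ne2 in auto)
  have X5: "?X c" by (rule conn_step[OF X2]) (use V C in auto)
  have X6: "?X c'" by (rule conn_step[OF X5]) (use V C ne2 in auto)
  note sX = branch_separated[OF V(1,4,5) tri(1) A(1-4,6)]
  let ?Y = "conn E (V - {y}) x"
  have Y1: "?Y x" using V ne by (intro conn_refl) auto
  have Y2: "?Y z" by (rule conn_step[OF Y1]) (use V ne tri in auto)
  have Y3: "?Y a" by (rule conn_step[OF Y1]) (use V A in auto)
  have Y4: "?Y a'" by (rule conn_step[OF Y3]) (use V A ne2 in auto)
  have Y5: "?Y c" by (rule conn_step[OF Y2]) (use V C cy in auto)
  have Y6: "?Y c'" by (rule conn_step[OF Y5]) (use V C ne2 in auto)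
  note sY = branch_separated[OF V(2,6,7) tri'(1) B(1-4,6)]
  let ?Z = "conn E (V - {z}) x"
  have Z1: "?Z x" using V ne by (intro conn_refl) auto
  have Z2: "?Z y" by (rule conn_step[OF Z1]) (use V ne tri in auto)
  have Z3: "?Z a" by (rule conn_step[OF Z1]) (use V A az in auto)
  have Z4: "?Z a'" by (rule conn_step[OF Z3]) (use V A ne2 in auto)
  have Z5: "?Z b" by (rule conn_step[OF Z2]) (use V B bz in auto)
  have Z6: "?Z b'" by (rule conn_step[OF Z5]) (use V B ne2 in auto)
  note sZ = branch_separated[OF V(3,8,9) tri'(3) C(1-4,6)]
  note sep = sX[OF X1] sX[OF X2] sX[OF X3] sX[OF X4] sX[OF X5] sX[OF X6]
    sY[OF Y1] sY[OF Y2] sY[OF Y3] sY[OF Y4] sY[OF Y5] sY[OF Y6]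
    sZ[OF Z1] sZ[OF Z2] sZ[OF Z3] sZ[OF Z4] sZ[OF Z5] sZ[OF Z6]
  have own: "E a x" "E b y" "E c z" "E a' a" "E b' b" "E c' c" "\<not> E x a'" "\<not> E y b'" "\<not> E z c'"
    using A B C sym by blast+
  have own2: "a \<noteq> a'" "b \<noteq> b'" "c \<noteq> c'" using A(4) B(4) C(4) irr by blast+
  let ?l = "[a', a, x, y, z, c, c', b, b']"
  let ?f = "\<lambda>i. ?l ! (i - 1)"
  have nine: "{1..9::nat} = {1, 2, 3, 4, 5, 6, 7, 8, 9}" by auto
  have d: "distinct ?l" using sep ne self own2 A(6) B(6) C(6) by auto
  have "inj_on ?f {1..9}"
    by (intro inj_onI) (use d in \<open>auto simp: nth_eq_iff_index_eq\<close>)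
  moreover have "?f ` {1..9} \<subseteq> V" unfolding nine using V by simp
  moreover have "E (?f i) (?f j) \<longleftrightarrow> (i, j) \<in> T3_edges \<union> T3_edges\<inverse>" if "i \<in> {1..9}" "j \<in> {1..9}" for i j
  proof -
    have r: "\<And>u v. (u, v) \<in> T3_edges \<union> T3_edges\<inverse> \<longleftrightarrow> (u, v) \<in> T3_edges \<or> (v, u) \<in> T3_edges" by blast
    show ?thesis using that unfolding nine r T3_edges_def
      by (elim insertE emptyE)
         (simp_all add: irr sep own tri tri' A(1,4,5) B(1,4,5) C(1,4,5))
  qed
  ultimately show ?thesis by blast
qed

end

section \<open>Exchange vertices in block graphs\<close>

text \<open>Meant for \<open>V\<close> the union of all faces above \<open>X\<close>, so that
  \<open>V - X\<close> is the set of alive vertices and the faces above \<open>X\<close> are the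
  \<open>small\<close> sets between \<open>X\<close> and \<open>V\<close>.\<close>

locale face_extension = block_rel +
  fixes X :: "'a set"
  assumes XV: "X \<subseteq> V"
    and small_ext: "v \<in> V - X \<Longrightarrow> small E (insert v X)"
begin

definition good :: "'a \<Rightarrow> bool" where
  "good v \<longleftrightarrow> (\<forall>F S T. F \<subseteq> V \<and> small E F \<and> v \<notin> F \<and> X \<subseteq> S \<and> S \<subseteq> F \<and> X \<subseteq> T \<and> T \<subseteq> F \<and>
     \<not> small E (insert v S) \<and> \<not> small E (insert v T) \<longrightarrow> \<not> small E (insert v (S \<inter> T)))"

definition simplicial :: "'a \<Rightarrow> bool" where
  "simplicial v \<longleftrightarrow> (\<forall>a \<in> V. \<forall>b \<in> V. E v a \<and> E v b \<and> a \<noteq> b \<longrightarrow> E a b)"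

text \<open>\<open>desc r p\<close> includes \<open>p\<close> itself, and \<open>desc r r\<close> is the whole component of \<open>r\<close>, because nothing is
  connected to \<open>r\<close> in \<open>V - {r}\<close>.\<close>

definition desc :: "'a \<Rightarrow> 'a \<Rightarrow> 'a set" where
  "desc r p = {x. conn E V r x \<and> \<not> conn E (V - {p}) r x}"

lemma not_goodE:
  assumes "\<not> good v"
  obtains F S T where "F \<subseteq> V" "small E F" "v \<notin> F" "X \<subseteq> S" "S \<subseteq> F" "X \<subseteq> T" "T \<subseteq> F"
    "\<not> small E (insert v S)" "\<not> small E (insert v T)" "small E (insert v (S \<inter> T))"
proof -
  have "\<exists>F S T. F \<subseteq> V \<and> small E F \<and> v \<notin> F \<and> X \<subseteq> S \<and> S \<subseteq> F \<and> X \<subseteq> T \<and> T \<subseteq> F \<and>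
     \<not> small E (insert v S) \<and> \<not> small E (insert v T) \<and> small E (insert v (S \<inter> T))"
    using assms unfolding good_def by simp
  then show thesis by (elim exE conjE) (rule that)
qed

lemma finite_sub: "A \<subseteq> V \<Longrightarrow> finite A"
  by (rule finite_subset[OF _ fin])

lemma no_four:
  assumes "small E A" "A \<subseteq> V" "conn E A a b" "conn E A a c" "conn E A a d" "distinct [a, b, c, d]"
  shows False
  using four_connected_not_small[OF finite_sub[OF assms(2)] assms(3-6)] assms(1) by blast

lemma comp_big:
  assumes "\<not> small E (insert v S)" "small E S" "S \<subseteq> V"
  shows "card {b. conn E (insert v S) v b} > 3"
  using not_small_insert[OF sym finite_sub[OF assms(3)] assms(2,1)] .

text \<open>The neighbours of \<open>v\<close> in \<open>F\<close> form a clique, so they lie in one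
  component \<open>C\<close> of \<open>F\<close>, of size at most 3. A component of \<open>v\<close>
  with more than three vertices must then be all of \<open>insert v C\<close> with
  \<open>card C = 3\<close>. Thus \<open>S\<close> and \<open>T\<close> block \<open>v\<close> only
  by containing \<open>C\<close>, and so does \<open>S \<inter> T\<close>.\<close>

lemma simplicial_good:
  assumes v: "v \<in> V" "simplicial v"
  shows "good v"
proof (rule ccontr)
  assume "\<not> good v"
  then obtain F S T where F: "F \<subseteq> V" "small E F" "v \<notin> F"
    and ST: "X \<subseteq> S" "S \<subseteq> F" "X \<subseteq> T" "T \<subseteq> F" "\<not> small E (insert v S)" "\<not> small E (insert v T)"
    and sm: "small E (insert v (S \<inter> T))"
    by (rule not_goodE)
  have comp: "\<exists>s \<in> S. E v s \<and> {b. conn E F s b} \<subseteq> S \<and> card {b. conn E F s b} = 3"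
    if S: "S \<subseteq> F" "\<not> small E (insert v S)" for S
  proof -
    have SV: "S \<subseteq> V" using S(1) F(1) by blast
    have "small E S" using small_subset[OF F(2) S(1) finite_sub[OF F(1)]] .
    from comp_big[OF S(2) this SV] have big: "card {b. conn E (insert v S) v b} > 3" .
    then have "card {v} < card {b. conn E (insert v S) v b}" by simp
    then obtain s where "s \<in> insert v S" "s \<notin> {v}" "E v s"
      by (rule comp_leaves_set) auto
    then have s: "s \<in> S" "E v s" by blast+
    let ?C = "{b. conn E F s b}"
    have sF: "s \<in> F" using s S by blast
    have "b \<in> insert v ?C" if "conn E (insert v S) v b" for b
      using that
    proof induction
      case (conn_step b c)
      show ?case
      proof (cases "c = v")
        case False
        then have cF: "c \<in> F" using conn_step.hyps S by blast
        have "conn E F s c"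
        proof (cases "b = v")
          case True
          have "E s c" if "s \<noteq> c"
            using v(2) s True conn_step.hyps(2) cF sF F(1) that unfolding simplicial_def by blast
          then show ?thesis using conn_refl[OF sF] conn_edge[OF _ sF cF] by blast
        next
          case False
          then have "conn E F s b" using conn_step.IH by blast
          then show ?thesis using conn_step.hyps(2) cF by (rule conn.conn_step)
        qed
        then show ?thesis by blast
      qed simp
    qed simp
    then have sub: "{b. conn E (insert v S) v b} \<subseteq> insert v ?C" by blast
    have finC: "finite ?C" by (rule finite_comp[OF finite_sub[OF F(1)]])
    have vC: "v \<notin> ?C" using F(3) conn_in(2) by fast
    have C3: "card ?C \<le> 3" using F(2) sF unfolding small_def by blast
    then have le: "card (insert v ?C) \<le> card {b. conn E (insert v S) v b}"
      using big vC finC by simp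
    have eq: "{b. conn E (insert v S) v b} = insert v ?C"
      by (rule card_seteq[OF _ sub le]) (rule finite.insertI[OF finC])
    have "?C \<subseteq> insert v S"
    proof
      fix b assume "b \<in> ?C"
      then have "conn E (insert v S) v b" using eq by blast
      then show "b \<in> insert v S" by (rule conn_in(2))
    qed
    then have "?C \<subseteq> S" using vC by blast
    moreover have "card ?C = 3" using eq big vC finC C3 by simp
    ultimately show ?thesis using s by blast
  qed
  obtain s where s: "s \<in> S" "E v s" "{b. conn E F s b} \<subseteq> S" "card {b. conn E F s b} = 3"
    using comp[OF ST(2,5)] by blast
  obtain t where t: "t \<in> T" "E v t" "{b. conn E F t b} \<subseteq> T"
    using comp[OF ST(4,6)] by blast
  have sF: "s \<in> F" "t \<in> F" using s t ST by blast+
  have "E t s" if "s \<noteq> t" using v s t sF F that unfolding simplicial_def by blast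
  then have ts: "conn E F t s" using conn_refl[OF sF(1)] conn_edge[OF _ sF(2,1)] by blast
  let ?C = "{b. conn E F s b}" and ?W = "insert v (S \<inter> T)"
  have CT: "?C \<subseteq> S \<inter> T" using s(3) t(3) conn_trans[OF ts] by blast
  have vs: "conn E ?W v s" using s(2) CT conn_refl[OF sF(1)] by (intro conn_edge) auto
  have "conn E ?W v b" if "conn E F s b" for b
    using that
  proof induction
    case (conn_step b c)
    have "conn E F s c" using conn_step.hyps by (rule conn.conn_step)
    then have "c \<in> ?W" using CT by blast
    with conn_step.IH conn_step.hyps(2) show ?case by (rule conn.conn_step)
  qed (rule vs)
  then have "insert v ?C \<subseteq> {b. conn E ?W v b}" by (auto intro: conn_refl)
  then have "card (insert v ?C) \<le> card {b. conn E ?W v b}"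
    by (rule card_mono[rotated]) (intro finite_comp finite_sub, use ST F v in blast)
  moreover have "v \<notin> ?C" using F(3) conn_in(2) by fast
  moreover have "finite ?C" by (rule finite_comp[OF finite_sub[OF F(1)]])
  ultimately have "card {b. conn E ?W v b} > 3" using s(4) by simp
  then show False using sm unfolding small_def by fastforce
qed

text \<open>Nothing ever blocks \<open>r\<close>: its component in \<open>insert r S\<close> uses
  only vertices of \<open>insert r X\<close>, which is small, so the exchange condition is
  vacuous.\<close>

lemma isolated_good:
  assumes r: "r \<in> V - X" and only: "\<And>c. conn E V r c \<Longrightarrow> c = r \<or> c \<in> X"
  shows "good r"
proof (rule ccontr)
  assume "\<not> good r"
  then obtain F S T where F: "F \<subseteq> V" "small E F" "r \<notin> F"
    and ST: "X \<subseteq> S" "S \<subseteq> F" "X \<subseteq> T" "T \<subseteq> F" "\<not> small E (insert r S)" "\<not> small E (insert r T)"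
    and sm: "small E (insert r (S \<inter> T))"
    by (rule not_goodE)
  have SV: "S \<subseteq> V" using ST F by blast
  have "small E S" using small_subset[OF F(2) ST(2) finite_sub[OF F(1)]] .
  then have big: "card {b. conn E (insert r S) r b} > 3" by (rule comp_big[OF ST(5) _ SV])
  have "conn E (insert r X) r b" if "conn E (insert r S) r b" for b
    using that
  proof induction
    case (conn_step b c)
    have "conn E (insert r S) r c" using conn_step.hyps by (rule conn.conn_step)
    then have "conn E V r c" by (rule conn_mono) (use SV r in blast)
    then have "c \<in> insert r X" using only by blast
    with conn_step.IH conn_step.hyps(2) show ?case by (rule conn.conn_step)
  qed (simp add: conn_refl)
  then have "card {b. conn E (insert r S) r b} \<le> card {b. conn E (insert r X) r b}"
    by (intro card_mono finite_comp finite_sub) (use XV r in auto)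
  then show False using big small_ext[OF r] unfolding small_def by fastforce
qed

text \<open>Two non-adjacent neighbours of \<open>v\<close> cannot both be adjacent to
  \<open>q\<close>, since \<open>v\<close> and \<open>q\<close> would be two common neighbours of
  them. This produces a vertex leaving the block of \<open>v\<close> and \<open>q\<close>.\<close>

lemma nonneighbour_of:
  assumes "v \<in> V" "\<not> simplicial v" "E v q" "q \<in> V"
  obtains w where "w \<in> V" "E v w" "w \<noteq> q" "\<not> E w q"
proof -
  obtain a b where ab: "a \<in> V" "b \<in> V" "E v a" "E v b" "a \<noteq> b" "\<not> E a b"
    using assms(2) unfolding simplicial_def by blast
  have vq: "q \<noteq> v" using assms(3) irr by blast
  show thesis
  proof (cases "a = q \<or> E a q")
    case True
    have "b \<noteq> q" using True ab sym by blast
    moreover have "\<not> E b q"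
    proof
      assume bq: "E b q"
      then have "E a q" using True ab(6) sym by blast
      then show False
        using diamond[OF ab(3,4) sym sym[OF bq] ab(5) vq assms(1,4) ab(1,2)] ab(6) by blast
    qed
    ultimately show thesis using that ab by blast
  qed (use that ab in blast)
qed

lemma desc_step:
  assumes "x \<in> desc r q" "E x w" "w \<in> V" "w \<noteq> q" "x \<noteq> q"
  shows "w \<in> desc r q"
proof -
  have x: "conn E V r x" "\<not> conn E (V - {q}) r x" using assms(1) unfolding desc_def by blast+
  have "x \<in> V" using x(1) by (rule conn_in(2))
  have "conn E V r w" using x(1) assms(2,3) by (rule conn_step)
  moreover have "\<not> conn E (V - {q}) r w"
  proof
    assume "conn E (V - {q}) r w"
    then have "conn E (V - {q}) r x"
      by (rule conn_step) (use sym[OF assms(2)] \<open>x \<in> V\<close> assms(5) in auto)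
    then show False using x(2) by blast
  qed
  ultimately show ?thesis unfolding desc_def by blast
qed

end

section \<open>Structure below a lowest branch point\<close>

locale branch_point = face_extension +
  fixes r p :: 'a
  assumes rp: "conn E V r p"
    and minimal: "\<lbrakk>conn E V r q; card (desc r q) < card (desc r p); c \<in> V - X; c \<in> desc r q\<rbrakk> \<Longrightarrow> c = q"
    and not_simplicial: "v \<in> V - X \<Longrightarrow> \<not> simplicial v"
begin

definition D :: "'a set" where
  "D = desc r p - {p}"

text \<open>The neighbours of \<open>c\<close> in the block containing \<open>c\<close> and \<open>p\<close>, provided \<open>c\<close> is adjacent to \<open>p\<close>.\<close>

definition K :: "'a \<Rightarrow> 'a set" where
  "K c = {w \<in> V. E c w \<and> (w = p \<or> E w p)}"

lemma pV: "p \<in> V" and rV: "r \<in> V"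
  using conn_in[OF rp] by auto

lemma D_iff: "x \<in> D \<longleftrightarrow> conn E V r x \<and> \<not> conn E (V - {p}) r x \<and> x \<noteq> p"
  unfolding D_def desc_def by blast

lemma DV: "x \<in> D \<Longrightarrow> x \<in> V"
  unfolding D_iff by (blast dest: conn_in(2))

lemma D_step: "c \<in> D \<Longrightarrow> E c w \<Longrightarrow> w \<in> V \<Longrightarrow> w = p \<or> w \<in> D"
  using desc_step[of c r p w] unfolding D_def by blast

lemma r_notin_D: "r \<notin> D"
proof
  assume "r \<in> D"
  then have "\<not> conn E (V - {p}) r r" "r \<noteq> p" unfolding D_iff by blast+
  then show False using rV conn_refl[of r "V - {p}" E] by blast
qed

text \<open>\<open>p\<close> is the only exit from \<open>D\<close>. Recording that the walk stays
  in \<open>insert p D\<close> until then later places a separator inside \<open>D\<close>.\<close>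

lemma leaves_D_via_p:
  assumes c: "c \<in> D" and cw: "conn E W c w" and W: "W \<subseteq> V"
  shows "conn E (W \<inter> insert p D) c p \<or> (w \<in> D \<and> conn E (W \<inter> insert p D) c w)"
  using cw
proof induction
  case conn_refl
  then show ?case using c conn.conn_refl[of c "W \<inter> insert p D" E] by blast
next
  case (conn_step b d)
  show ?case
  proof (cases "conn E (W \<inter> insert p D) c p")
    case False
    then have b: "b \<in> D" "conn E (W \<inter> insert p D) c b" using conn_step.IH by blast+
    have d: "d = p \<or> d \<in> D" using D_step[OF b(1) conn_step.hyps(2)] conn_step.hyps(3) W by blast
    have "conn E (W \<inter> insert p D) c d"
      using b(2) conn_step.hyps(2) by (rule conn.conn_step) (use d conn_step.hyps(3) in blast)
    then show ?thesis using d by blast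
  qed simp
qed

lemma to_root_via_p:
  assumes "c \<in> D" "conn E W c r" "W \<subseteq> V"
  shows "conn E W c p"
proof -
  have "conn E (W \<inter> insert p D) c p" using leaves_D_via_p[OF assms] r_notin_D by blast
  then show ?thesis by (rule conn_mono) blast
qed

lemma avoids_D:
  assumes c: "c \<in> D" and x: "conn E (V - {p}) r x"
  shows "conn E (V - {c}) r x"
  using x
proof induction
  case conn_refl
  have "r \<noteq> c" using c r_notin_D by blast
  then show ?case using rV by (intro conn.conn_refl) blast
next
  case (conn_step b d)
  have "conn E (V - {p}) r d" using conn_step.hyps by (rule conn.conn_step)
  then have "d \<noteq> c" using c unfolding D_iff by blast
  then have "d \<in> V - {c}" using conn_step.hyps(3) by blast
  with conn_step.IH conn_step.hyps(2) show ?case by (rule conn.conn_step)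
qed

text \<open>Up to its first arrival at \<open>p\<close>, a walk from the root avoids
  \<open>p\<close>, hence never enters \<open>D\<close> and in particular avoids
  \<open>c\<close>.\<close>

lemma p_notin_desc:
  assumes c: "c \<in> D"
  shows "p \<notin> desc r c"
proof -
  have pc: "p \<noteq> c" using c unfolding D_iff by blast
  have "conn E (V - {c}) r p \<or> conn E (V - {p}) r x" if "conn E V r x" for x
    using that
  proof induction
    case conn_refl
    show ?case
    proof (cases "r = p")
      case True
      then show ?thesis using pc pV conn.conn_refl[of p "V - {c}" E] by blast
    next
      case False
      then show ?thesis using rV conn.conn_refl[of r "V - {p}" E] by blast
    qed
  next
    case (conn_step b d)
    show ?case
    proof (cases "conn E (V - {c}) r p")
      case False
      then have b: "conn E (V - {p}) r b" using conn_step.IH by blast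
      have "d \<noteq> p"
      proof
        assume "d = p"
        then have "conn E (V - {c}) r p"
          using conn.conn_step[OF avoids_D[OF c b] conn_step.hyps(2)] conn_step.hyps(3) pc by blast
        then show False using False by blast
      qed
      then have "conn E (V - {p}) r d"
        using conn.conn_step[OF b conn_step.hyps(2)] conn_step.hyps(3) by blast
      then show ?thesis by blast
    qed simp
  qed
  from this[OF rp] have "conn E (V - {c}) r p" using conn_in(2)[of E "V - {p}" r p] by blast
  then show ?thesis unfolding desc_def by blast
qed

lemma desc_subset:
  assumes c: "c \<in> D"
  shows "desc r c \<subseteq> D"
proof
  fix x assume x: "x \<in> desc r c"
  have "x \<noteq> p" using x p_notin_desc[OF c] by blast
  moreover have "\<not> conn E (V - {p}) r x" using avoids_D[OF c] x unfolding desc_def by blast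
  ultimately show "x \<in> D" using x unfolding D_iff desc_def by blast
qed

text \<open>\<open>desc r c\<close> is contained in \<open>desc r p\<close> and misses
  \<open>p\<close>, so it is smaller, and by minimality no alive vertex lies strictly below
  \<open>c\<close>.\<close>

lemma desc_in_X:
  assumes c: "c \<in> D" and x: "x \<in> desc r c" "x \<noteq> c"
  shows "x \<in> X"
proof (rule ccontr)
  assume "x \<notin> X"
  have fin': "finite (desc r p)"
    by (rule finite_sub) (auto simp: desc_def dest: conn_in(2))
  have "p \<in> desc r p" using rp conn_in(2)[of E "V - {p}" r p] unfolding desc_def by blast
  then have "desc r c \<subset> desc r p" using desc_subset[OF c] unfolding D_def by blast
  then have "card (desc r c) < card (desc r p)" by (rule psubset_card_mono[OF fin'])
  moreover have "conn E V r c" using c unfolding D_iff by blast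
  moreover have "x \<in> V - X" using x(1) \<open>x \<notin> X\<close> DV desc_subset[OF c] by blast
  ultimately show False using minimal x by blast
qed

text \<open>Otherwise a vertex \<open>q\<close> of \<open>D\<close> separates \<open>c\<close> from
  \<open>p\<close>, hence also from the root. Then \<open>c\<close> would be an alive vertex
  strictly below \<open>q\<close>.\<close>

lemma alive_adj_p:
  assumes c: "c \<in> D - X"
  shows "E p c"
proof (rule ccontr)
  assume n: "\<not> E p c"
  have cD: "c \<in> D" using c by blast
  have "conn E V c r" using cD cs unfolding D_iff by blast
  then have "conn E (V \<inter> insert p D) c p" using leaves_D_via_p[OF cD _ subset_refl] r_notin_D by blast
  then have pc: "conn E (V \<inter> insert p D) p c" by (rule cs)
  have "p \<noteq> c" using cD unfolding D_iff by blast
  then obtain q where q: "q \<in> V \<inter> insert p D" "q \<noteq> p" "q \<noteq> c" "\<not> conn E (V - {q}) p c"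
    using separator[OF pc] n by blast
  have qD: "q \<in> D" using q by blast
  have "\<not> conn E (V - {q}) r c"
  proof
    assume "conn E (V - {q}) r c"
    then have "conn E (V - {q}) c p" using to_root_via_p[OF cD cs] by blast
    then show False using q(4) cs by blast
  qed
  then have "c \<in> desc r q" using cD unfolding D_iff desc_def by blast
  then show False using desc_in_X[OF qD] q(3) c by blast
qed

text \<open>If such a \<open>w\<close> reached the root without \<open>c\<close>, it would reach
  \<open>p\<close> without \<open>c\<close>, and \<open>block\<close> at \<open>c\<close> would make
  it adjacent to \<open>p\<close>.\<close>

lemma far_neighbour_in_desc:
  assumes c: "c \<in> D - X" and w: "E c w" "w \<in> V" "w \<notin> K c"
  shows "w \<in> desc r c" "w \<noteq> c" "w \<in> X"
proof -
  have wp: "w \<noteq> p" "\<not> E w p" using w unfolding K_def by blast+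
  have cD: "c \<in> D" using c by blast
  have wD: "w \<in> D" using D_step[OF cD w(1,2)] wp(1) by blast
  show wc: "w \<noteq> c" using w(1) irr by blast
  have "\<not> conn E (V - {c}) r w"
  proof
    assume "conn E (V - {c}) r w"
    then have "conn E (V - {c}) w p" using to_root_via_p[OF wD cs] by blast
    then have "E w p" by (rule block[OF DV[OF cD] w(1) sym[OF alive_adj_p[OF c]] wp(1)])
    then show False using wp(2) by blast
  qed
  then show "w \<in> desc r c" using wD unfolding D_iff desc_def by blast
  then show "w \<in> X" by (rule desc_in_X[OF cD _ wc])
qed

text \<open>The end of the arm \<open>p\<close>, \<open>c\<close>, \<open>leaf c\<close>. For alive
  \<open>c\<close> in \<open>D\<close> it exists because \<open>c\<close> is not simplicial, and it
  lies strictly below \<open>c\<close>, hence in \<open>X\<close> and in every face above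
  \<open>X\<close>.\<close>

definition leaf :: "'a \<Rightarrow> 'a" where
  "leaf c = (SOME l. l \<in> V \<and> E c l \<and> l \<noteq> p \<and> \<not> E l p)"

lemma leaf:
  assumes c: "c \<in> D - X"
  shows "E c (leaf c)" "leaf c \<noteq> p" "\<not> E (leaf c) p" "leaf c \<in> X" "leaf c \<noteq> c" "leaf c \<in> desc r c"
    "leaf c \<in> V"
proof -
  have "c \<in> V - X" using c DV by blast
  then obtain w where "w \<in> V" "E c w" "w \<noteq> p" "\<not> E w p"
    using nonneighbour_of[OF _ not_simplicial sym[OF alive_adj_p[OF c]] pV] by blast
  then have "\<exists>l. l \<in> V \<and> E c l \<and> l \<noteq> p \<and> \<not> E l p" by blast
  from someI_ex[OF this] have l: "leaf c \<in> V" "E c (leaf c)" "leaf c \<noteq> p" "\<not> E (leaf c) p"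
    unfolding leaf_def by blast+
  then show "leaf c \<in> V" "E c (leaf c)" "leaf c \<noteq> p" "\<not> E (leaf c) p" by simp_all
  have "leaf c \<notin> K c" using l unfolding K_def by blast
  from far_neighbour_in_desc[OF c l(2,1) this]
  show "leaf c \<in> X" "leaf c \<noteq> c" "leaf c \<in> desc r c" by simp_all
qed

lemma leaf_neighbour:
  assumes c: "c \<in> D - X" and w: "E (leaf c) w" "w \<in> V" "w \<noteq> c"
  shows "w \<in> X"
proof -
  have "w \<in> desc r c" by (rule desc_step[OF leaf(6)[OF c] w leaf(5)[OF c]])
  then show ?thesis using desc_in_X w(3) c by blast
qed

text \<open>A common leaf would share with \<open>p\<close> the two neighbours \<open>s\<close> and
  \<open>t\<close>, so \<open>diamond\<close> would make it adjacent to \<open>p\<close>.\<close>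

lemma leaf_inj:
  assumes "s \<in> D - X" "t \<in> D - X" "s \<noteq> t"
  shows "leaf s \<noteq> leaf t"
proof
  assume e: "leaf s = leaf t"
  have "E (leaf s) p"
    using diamond[of s "leaf s" p t] leaf[OF assms(1)] leaf(1)[OF assms(2)] e assms
      sym[OF alive_adj_p[OF assms(1)]] sym[OF alive_adj_p[OF assms(2)]] pV DV by auto
  then show False using leaf(3)[OF assms(1)] by blast
qed

lemma K_clique:
  assumes c: "c \<in> D - X" and ab: "a \<in> K c" "b \<in> K c" "a \<noteq> b"
  shows "E a b"
proof -
  have a: "a \<in> V" "E c a" "a = p \<or> E a p" and b: "b \<in> V" "E c b" "b = p \<or> E b p"
    using ab unfolding K_def by blast+
  have "p \<noteq> c" "c \<in> V" using c DV D_iff by blast+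
  then have "E a b" if "E a p" "E b p"
    using diamond[OF a(2) b(2) sym[OF that(1)] sym[OF that(2)] ab(3)] pV a b by blast
  then show ?thesis using a(3) b(3) ab(3) sym by blast
qed

lemma K_cases:
  assumes "c \<in> D" "k \<in> K c" "k \<noteq> p"
  shows "k \<in> D"
  using assms D_step unfolding K_def by blast

text \<open>If \<open>S\<close> misses the block of \<open>c\<close> and \<open>p\<close>, the
  component of \<open>c\<close> in \<open>insert c S\<close> stays below \<open>c\<close>, hence in
  \<open>insert c X\<close>, which is small.\<close>

lemma meets_K:
  assumes c: "c \<in> D - X" and S: "X \<subseteq> S" "S \<subseteq> V" "small E S" "\<not> small E (insert c S)"
  obtains s where "s \<in> S" "s \<in> K c"
proof -
  have cV: "c \<in> V - X" using c DV by blast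
  have "\<exists>s \<in> S. s \<in> K c"
  proof (rule ccontr)
    assume n: "\<not> ?thesis"
    have cd: "c \<in> desc r c"
      using c conn_in(2)[of E "V - {c}" r c] D_iff[of c] unfolding desc_def by blast
    have "conn E (insert c X) c b \<and> b \<in> desc r c" if "conn E (insert c S) c b" for b
      using that
    proof induction
      case (conn_step b d)
      have b: "conn E (insert c X) c b" "b \<in> desc r c" using conn_step.IH by blast+
      have dV: "d \<in> V" using conn_step.hyps(3) S(2) cV by blast
      show ?case
      proof (cases "d = c")
        case True
        then show ?thesis using cd conn.conn_refl[of c "insert c X" E] by blast
      next
        case False
        have d: "d \<in> desc r c"
        proof (cases "b = c")
          case True
          have "d \<notin> K c" using n conn_step.hyps(3) False by blast
          then show ?thesis using far_neighbour_in_desc(1)[OF c] conn_step.hyps(2) True dV by blast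
        next
          case bc: False
          show ?thesis by (rule desc_step[OF b(2) conn_step.hyps(2) dV False bc])
        qed
        then have "d \<in> X" using desc_in_X False c by blast
        then have "conn E (insert c X) c d"
          using conn.conn_step[OF b(1) conn_step.hyps(2)] by blast
        then show ?thesis using d by blast
      qed
    qed (simp add: cd conn.conn_refl)
    then have "{b. conn E (insert c S) c b} \<subseteq> {b. conn E (insert c X) c b}" by blast
    then have "card {b. conn E (insert c S) c b} \<le> card {b. conn E (insert c X) c b}"
      by (rule card_mono[rotated]) (intro finite_comp finite_sub, use XV cV in blast)
    then show False using comp_big[OF S(4,3,2)] small_ext[OF cV] unfolding small_def by fastforce
  qed
  then show thesis using that by blast
qed

end

section \<open>Exchange vertices below the branch point, or twins elsewhere\<close>

context branch_point
begin

text \<open>The three edges form the path \<open>b\<close>, \<open>a\<close>, \<open>c\<close>,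
  \<open>d\<close>. This is where the bound 3 is contradicted throughout the case analysis.\<close>

lemma no_path4:
  assumes "small E A" "A \<subseteq> V" "a \<in> A" "b \<in> A" "c \<in> A" "d \<in> A" "E a b" "E a c" "E c d"
    "distinct [a, b, c, d]"
  shows False
proof (rule no_four[OF assms(1,2) _ _ _ assms(10)])
  show "conn E A a b" "conn E A a c" using assms by (simp_all add: conn_edge)
  then show "conn E A a d" using assms by (blast intro: conn_step)
qed

text \<open>Adjacency of \<open>s\<close> and \<open>t\<close> is derived from \<open>block\<close>
  at \<open>p\<close>, since both reach the root without \<open>p\<close>. The condition on
  \<open>X\<close> makes every other neighbour of \<open>s\<close> and \<open>t\<close> in
  \<open>V\<close> alive.\<close>

definition twins :: "'a \<Rightarrow> 'a \<Rightarrow> bool" where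
  "twins s t \<longleftrightarrow> s \<noteq> t \<and> E p s \<and> E p t \<and> s \<in> V - X - D \<and> t \<in> V - X - D \<and>
     (\<forall>z \<in> X. E s z \<or> E t z \<longrightarrow> z = p)"

lemma K_leaf:
  assumes "c \<in> D - X" "leaf c \<in> K d"
  shows False
  using leaf[OF assms(1)] assms(2) unfolding K_def by blast

lemma two_branches_contra:
  assumes c: "c \<in> D - X" and F: "small E F" "F \<subseteq> V" "X \<subseteq> F"
    and s: "s \<in> F" "s \<in> K c" "s \<in> D - X" and t: "t \<in> F" "t \<in> K c" "t \<in> D - X" and "s \<noteq> t"
  shows False
proof (rule no_path4[OF F(1,2)])
  show "s \<in> F" "leaf s \<in> F" "t \<in> F" "leaf t \<in> F" using s t leaf(4) F(3) by blast+
  show "E s (leaf s)" "E s t" "E t (leaf t)"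
    using leaf(1) s t K_clique[OF c s(2) t(2)] assms(11) by blast+
  show "distinct [s, leaf s, t, leaf t]"
    using leaf_inj[OF s(3) t(3) assms(11)] leaf(4,5)[OF s(3)] leaf(4,5)[OF t(3)] assms(11) s(3) t(3) by auto
qed

text \<open>\<open>c\<close>, \<open>leaf c\<close> and \<open>y\<close> fill a component of
  \<open>insert c X\<close>, so an obstruction needs a fourth, alive vertex, and it is attached to
  \<open>y\<close>. Let \<open>s\<close> and \<open>t\<close> be such vertices of \<open>S\<close>
  and \<open>T\<close>; they differ, as otherwise \<open>S \<inter> T\<close> would block
  \<open>c\<close>. Both are in \<open>F\<close>, and a leaf of either would complete a four-vertex
  path through \<open>y\<close>, so neither is in \<open>D\<close>. This forces
  \<open>y = p\<close>, and leaves no place for further neighbours in \<open>X\<close>.\<close>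

lemma X_neighbour_twins:
  assumes c: "c \<in> D - X" and y: "y \<in> X" "y \<in> K c" and "\<not> good c"
  shows "\<exists>s t. twins s t"
proof -
  obtain F S T where F: "F \<subseteq> V" "small E F" "c \<notin> F"
    and ST: "X \<subseteq> S" "S \<subseteq> F" "X \<subseteq> T" "T \<subseteq> F" "\<not> small E (insert c S)" "\<not> small E (insert c T)"
    and sm: "small E (insert c (S \<inter> T))"
    using assms(4) by (rule not_goodE)
  let ?l = "leaf c"
  note l = leaf[OF c]
  have cV: "c \<in> V - X" and cD: "c \<in> D" using c DV by blast+
  have yl: "y \<noteq> ?l" using K_leaf[OF c] y(2) by blast
  have cy: "E c y" "y \<in> V" "y = p \<or> E y p" using y(2) unfolding K_def by blast+
  have yc: "y \<noteq> c" using cy(1) irr by blast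
  have step: "\<exists>s \<in> S. s \<notin> X \<and> E y s \<and> s \<noteq> c \<and> s \<noteq> ?l \<and> s \<noteq> y"
    if S: "X \<subseteq> S" "S \<subseteq> F" "\<not> small E (insert c S)" for S
  proof -
    have SV: "S \<subseteq> V" using S F by blast
    have "small E S" using small_subset[OF F(2) S(2) finite_sub[OF F(1)]] .
    from comp_big[OF S(3) this SV] have "card {c, ?l, y} < card {b. conn E (insert c S) c b}"
      using l(5) yl yc by simp
    then obtain m s where m: "m \<in> {c, ?l, y}" "s \<in> insert c S" "s \<notin> {c, ?l, y}" "E m s"
      by (rule comp_leaves_set) auto
    have s: "s \<in> S" "s \<in> V" using m SV by blast+
    have ys: "E y s" if "E c s" "s \<in> K c" using K_clique[OF c y(2) that(2)] m(3) by blast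
    consider "m = c" | "m = ?l" | "m = y" using m(1) by blast
    then have "E y s \<or> s \<in> X"
    proof cases
      case 1
      then show ?thesis using ys far_neighbour_in_desc(3)[OF c, of s] m(4) s(2) by blast
    next
      case 2
      then show ?thesis using leaf_neighbour[OF c, of s] m(3,4) s(2) by blast
    next
      case 3
      then show ?thesis using m(4) by blast
    qed
    moreover have "s \<notin> X"
    proof
      assume sX': "s \<in> X"
      have A: "insert c X \<subseteq> V" using XV cV by blast
      have mem: "c \<in> insert c X" "?l \<in> insert c X" "y \<in> insert c X" "s \<in> insert c X"
        using l(4) y(1) sX' by blast+
      have e: "E c ?l" "E c y" by fact+
      have c1: "conn E (insert c X) c ?l" "conn E (insert c X) c y" "conn E (insert c X) c c"
        using e mem conn_edge conn_refl by metis+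
      then have "conn E (insert c X) c m" using m(1) by blast
      then have c2: "conn E (insert c X) c s" using m(4) mem(4) by (rule conn_step)
      show False
        by (rule no_four[OF small_ext[OF cV] A c1(1,2) c2]) (use m(3) l(5) yl yc in auto)
    qed
    ultimately show ?thesis using s m(3) by blast
  qed
  obtain s where s: "s \<in> S" "s \<notin> X" "E y s" "s \<noteq> c" "s \<noteq> ?l" "s \<noteq> y" using step[OF ST(1,2,5)] by blast
  obtain t where t: "t \<in> T" "t \<notin> X" "E y t" "t \<noteq> c" "t \<noteq> ?l" "t \<noteq> y" using step[OF ST(3,4,6)] by blast
  have st: "s \<noteq> t"
  proof
    assume e: "s = t"
    show False
      by (rule no_path4[OF sm, of c ?l y s]) (use F ST cV l y cy s t e yl yc in auto)
  qed
  have sF: "s \<in> F" "t \<in> F" and XF: "X \<subseteq> F" using s t ST by blast+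
  have branch: False if u: "u \<in> F" "w \<in> F" "E y u" "E y w" "u \<in> D - X" "w \<notin> X" "u \<noteq> w" "u \<noteq> y" for u w
  proof (rule no_path4[OF F(2,1), of y w u "leaf u"])
    have "leaf u \<noteq> y" using cy(3) leaf(2,3)[OF u(5)] by blast
    then show "distinct [y, w, u, leaf u]"
      using u irr leaf(4,5)[OF u(5)] y(1) by auto
  qed (use u leaf[OF u(5)] XF y in auto)
  have yp: "y = p"
  proof (rule ccontr)
    assume np: "y \<noteq> p"
    have yD: "y \<in> D" using K_cases[OF cD y(2) np] .
    have nb: "u = p \<or> u \<in> D - X" if "u \<in> F" "u \<notin> X" "E y u" for u
      using D_step[OF yD that(3)] that F(1) by blast
    have "s \<in> D - X \<or> t \<in> D - X" using nb[OF sF(1) s(2,3)] nb[OF sF(2) t(2,3)] st by blast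
    then show False using branch[OF sF s(3) t(3)] branch[OF sF(2,1) t(3) s(3)] s t st by blast
  qed
  have sD: "s \<notin> D" using branch[OF sF s(3) t(3)] s t st by blast
  have tD: "t \<notin> D" using branch[OF sF(2,1) t(3) s(3)] s t st by blast
  have only: "z = p" if z: "z \<in> X" "E u z" "u \<in> F" "w \<in> F" "E p u" "E p w" "u \<notin> X" "w \<notin> X" "u \<noteq> w" for u w z
  proof (rule ccontr)
    assume "z \<noteq> p"
    then show False
      by (intro no_path4[OF F(2,1), of p w u z]) (use z y yp irr XF in auto)
  qed
  have "twins s t" unfolding twins_def
    using only[OF _ _ sF _ _ s(2) t(2) st] only[OF _ _ sF(2,1) _ _ t(2) s(2)] s t st sD tD sF F(1) yp by blast
  then show ?thesis by blast
qed

text \<open>Every vertex of \<open>K c\<close> has its own neighbour in \<open>X\<close>: its leaf,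
  or \<open>z\<close> in the case of \<open>p\<close>. Two vertices of \<open>K c\<close> therefore
  never lie in one face, so \<open>S\<close> and \<open>T\<close> meet \<open>K c\<close> in the
  same vertex \<open>s\<close>. Together with its mate, \<open>c\<close> and \<open>leaf c\<close>,
  it shows that \<open>S \<inter> T\<close> blocks \<open>c\<close>.\<close>

lemma X_pendant_good:
  assumes c: "c \<in> D - X" and K: "K c \<inter> X = {}" and z: "p \<notin> X" "z \<in> X" "E p z"
  shows "good c"
proof (rule ccontr)
  assume "\<not> good c"
  then obtain F S T where F: "F \<subseteq> V" "small E F" "c \<notin> F"
    and ST: "X \<subseteq> S" "S \<subseteq> F" "X \<subseteq> T" "T \<subseteq> F" "\<not> small E (insert c S)" "\<not> small E (insert c T)"
    and sm: "small E (insert c (S \<inter> T))"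
    by (rule not_goodE)
  have cV: "c \<in> V - X" and cD: "c \<in> D" using c DV by blast+
  have XF: "X \<subseteq> F" using ST by blast
  define mate where "mate k = (if k = p then z else leaf k)" for k
  have KD: "k \<in> D - X" if "k \<in> K c" "k \<noteq> p" for k using K_cases[OF cD that] K that(1) by blast
  have mate: "mate k \<in> X" "E k (mate k)" if "k \<in> K c" for k
    using KD[OF that] z leaf(1,4)[of k] unfolding mate_def by auto
  have mate_inj: "mate k \<noteq> mate k'" if "k \<in> K c" "k' \<in> K c" "k \<noteq> k'" for k k'
    using KD[OF that(1)] KD[OF that(2)] leaf_inj[of k k'] leaf(3)[of k] leaf(3)[of k'] z(3) sym that
    unfolding mate_def by auto
  have mate_c: "mate k \<noteq> leaf c" if "k \<in> K c" for k
  proof (cases "k = p")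
    case True
    then show ?thesis using leaf(3)[OF c] z(3) sym unfolding mate_def by auto
  next
    case False
    have "k \<noteq> c" using that irr unfolding K_def by blast
    then show ?thesis using leaf_inj[OF KD[OF that False] c] False unfolding mate_def by simp
  qed
  have sub: "S \<subseteq> V" "T \<subseteq> V" "small E S" "small E T"
    using ST F small_subset[OF F(2) _ finite_sub[OF F(1)]] by blast+
  obtain s where s: "s \<in> S" "s \<in> K c" using meets_K[OF c ST(1) sub(1,3) ST(5)] .
  obtain t where t: "t \<in> T" "t \<in> K c" using meets_K[OF c ST(3) sub(2,4) ST(6)] .
  have nX: "s \<notin> X" "t \<notin> X" using s t K by blast+
  have "s = t"
  proof (rule ccontr)
    assume st: "s \<noteq> t"
    show False
    proof (rule no_path4[OF F(2,1), of s "mate s" t "mate t"])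
      show "E s t" by (rule K_clique[OF c s(2) t(2) st])
      show "distinct [s, mate s, t, mate t]"
        using st mate_inj[OF s(2) t(2) st] mate(1)[OF s(2)] mate(1)[OF t(2)] nX by auto
    qed (use s t ST mate XF in auto)
  qed
  show False
  proof (rule no_path4[OF sm, of c "leaf c" s "mate s"])
    show "distinct [c, leaf c, s, mate s]"
      using mate_c[OF s(2)] mate(1)[OF s(2)] nX leaf(4,5)[OF c] cV s(1) ST(2) F(3) by auto
    show "E c s" using s(2) unfolding K_def by blast
  qed (use s t \<open>s = t\<close> ST mate[OF s(2)] leaf[OF c] F cV in auto)
qed

text \<open>By \<open>big\<close>, a face above \<open>X\<close> cannot contain \<open>p\<close>
  along with an alive vertex of \<open>D\<close>, and two alive vertices of \<open>K c\<close> in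
  \<open>D\<close> are excluded by their leaves. So \<open>S\<close> and \<open>T\<close> again
  share their vertex of \<open>K c\<close>. If it is \<open>p\<close>, then \<open>big\<close> for
  \<open>c\<close> shows that \<open>S \<inter> T\<close> blocks \<open>c\<close>; otherwise its
  leaf does.\<close>

lemma blocked_good:
  assumes c: "c \<in> D - X" and K: "K c \<inter> X = {}" and p: "p \<notin> X"
    and big: "\<And>d. d \<in> D - X \<Longrightarrow> \<not> small E (insert d (insert p X))"
  shows "good c"
proof (rule ccontr)
  assume "\<not> good c"
  then obtain F S T where F: "F \<subseteq> V" "small E F" "c \<notin> F"
    and ST: "X \<subseteq> S" "S \<subseteq> F" "X \<subseteq> T" "T \<subseteq> F" "\<not> small E (insert c S)" "\<not> small E (insert c T)"
    and sm: "small E (insert c (S \<inter> T))"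
    by (rule not_goodE)
  have cV: "c \<in> V - X" and cD: "c \<in> D" using c DV by blast+
  have XF: "X \<subseteq> F" using ST by blast
  have KD: "k \<in> D - X" if "k \<in> K c" "k \<noteq> p" for k using K_cases[OF cD that] K that(1) by blast
  have sub: "S \<subseteq> V" "T \<subseteq> V" "small E S" "small E T"
    using ST F small_subset[OF F(2) _ finite_sub[OF F(1)]] by blast+
  obtain s where s: "s \<in> S" "s \<in> K c" using meets_K[OF c ST(1) sub(1,3) ST(5)] .
  obtain t where t: "t \<in> T" "t \<in> K c" using meets_K[OF c ST(3) sub(2,4) ST(6)] .
  have sF: "s \<in> F" "t \<in> F" using s t ST by blast+
  have no_p: False if "p \<in> F" "d \<in> F" "d \<in> D - X" for d
    using big[OF that(3)] small_subset[OF F(2) _ finite_sub[OF F(1)], of "insert d (insert p X)"] that XF by blast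
  have st: "s = t"
  proof (rule ccontr)
    assume st: "s \<noteq> t"
    have sp: "s \<noteq> p" using no_p[of t] sF KD[OF t(2)] st by blast
    have tp: "t \<noteq> p" using no_p[of s] sF KD[OF s(2)] st by blast
    show False
      by (rule two_branches_contra[OF c F(2,1) XF sF(1) s(2) KD[OF s(2) sp] sF(2) t(2) KD[OF t(2) tp] st])
  qed
  have "s \<noteq> p"
  proof
    assume "s = p"
    then have "insert c (insert p X) \<subseteq> insert c (S \<inter> T)" using s t st ST by blast
    then have "small E (insert c (insert p X))"
      using small_subset[OF sm] finite_sub[of "insert c (S \<inter> T)"] F ST cV by blast
    then show False using big[OF c] by blast
  qed
  then have sD: "s \<in> D - X" using KD[OF s(2)] by blast
  have sc: "s \<noteq> c" using s(1) ST(2) F(3) by blast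
  show False
  proof (rule no_path4[OF sm, of c "leaf c" s "leaf s"])
    show "distinct [c, leaf c, s, leaf s]"
      using leaf_inj[OF sD c sc] leaf(4,5)[OF c] leaf(4,5)[OF sD] sD cV sc by auto
    show "E c s" using s(2) unfolding K_def by blast
  qed (use s t st ST leaf[OF sD] leaf[OF c] F cV in auto)
qed

text \<open>By \<open>ext\<close>, the set \<open>c\<close>, \<open>leaf c\<close>, \<open>p\<close>
  is a full component of \<open>insert c (insert p X)\<close>. An obstruction therefore contains an
  alive vertex of \<open>K c\<close> other than \<open>p\<close>, or else \<open>p\<close> with an
  alive neighbour not adjacent to \<open>c\<close>. Leaves rule out the first kind for
  \<open>S\<close> or \<open>T\<close>. In the second kind the two neighbours of \<open>p\<close>
  differ, as otherwise \<open>S \<inter> T\<close> would block \<open>c\<close>, and sharing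
  \<open>F\<close> with \<open>p\<close> they can have neither leaves nor neighbours in
  \<open>X\<close>.\<close>

lemma extendable_twins:
  assumes c: "c \<in> D - X" and K: "K c \<inter> X = {}" and p: "p \<notin> X"
    and no_X: "\<And>z. z \<in> X \<Longrightarrow> \<not> E p z"
    and ext: "small E (insert c (insert p X))" and "\<not> good c"
  shows "\<exists>s t. twins s t"
proof -
  obtain F S T where F: "F \<subseteq> V" "small E F" "c \<notin> F"
    and ST: "X \<subseteq> S" "S \<subseteq> F" "X \<subseteq> T" "T \<subseteq> F" "\<not> small E (insert c S)" "\<not> small E (insert c T)"
    and sm: "small E (insert c (S \<inter> T))"
    using assms(6) by (rule not_goodE)
  let ?l = "leaf c" and ?A = "insert c (insert p X)"
  note l = leaf[OF c]
  have cV: "c \<in> V - X" and cD: "c \<in> D" using c DV by blast+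
  have cp: "E c p" "p \<noteq> c" using sym[OF alive_adj_p[OF c]] irr by blast+
  have XF: "X \<subseteq> F" using ST by blast
  have KD: "k \<in> D - X" if "k \<in> K c" "k \<noteq> p" for k using K_cases[OF cD that] K that(1) by blast
  have step: "(\<exists>s \<in> S. s \<in> K c \<and> s \<noteq> p) \<or> (p \<in> S \<and> (\<exists>u \<in> S. E p u \<and> u \<notin> X \<and> \<not> E c u \<and> u \<noteq> c))"
    if S: "X \<subseteq> S" "S \<subseteq> F" "\<not> small E (insert c S)" for S
  proof (cases "\<exists>s \<in> S. s \<in> K c \<and> s \<noteq> p")
    case False
    have SV: "S \<subseteq> V" using S F by blast
    have smS: "small E S" using small_subset[OF F(2) S(2) finite_sub[OF F(1)]] .
    have pS: "p \<in> S" using meets_K[OF c S(1) SV smS S(3)] False by blast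
    from comp_big[OF S(3) smS SV] have "card {c, ?l, p} < card {b. conn E (insert c S) c b}"
      using l(2,5) cp(2) by simp
    then obtain m u where m: "m \<in> {c, ?l, p}" "u \<in> insert c S" "u \<notin> {c, ?l, p}" "E m u"
      by (rule comp_leaves_set) auto
    have u: "u \<in> S" "u \<in> V" using m SV by blast+
    have uX: "u \<notin> X"
    proof
      assume uX: "u \<in> X"
      have A: "?A \<subseteq> V" using XV cV pV by blast
      have mem: "c \<in> ?A" "?l \<in> ?A" "p \<in> ?A" "u \<in> ?A" using l(4) uX by blast+
      have c1: "conn E ?A c ?l" "conn E ?A c p" "conn E ?A c c"
        using l(1,4) cp(1) by (auto intro: conn_edge conn_refl)
      then have "conn E ?A c m" using m(1) by blast
      then have c2: "conn E ?A c u" using m(4) mem(4) by (rule conn_step)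
      show False by (rule no_four[OF ext A c1(1,2) c2]) (use m(3) l(2,5) cp(2) in auto)
    qed
    have ncu: "\<not> E c u"
    proof
      assume "E c u"
      then show False
        using far_neighbour_in_desc(3)[OF c _ u(2)] uX False u(1) m(3) by blast
    qed
    have "m \<noteq> ?l" using leaf_neighbour[OF c _ u(2)] m(3,4) uX by blast
    then have "E p u" using m(1,4) ncu by blast
    then show ?thesis using pS u(1) uX ncu m(3) by blast
  qed blast
  have mixed: False if "t \<in> F" "t \<in> K c" "t \<noteq> p" "p \<in> F" "u \<in> F" "E p u" "u \<notin> X" "\<not> E c u" for t u
  proof (rule no_path4[OF F(2,1), of p u t "leaf t"])
    note tD = KD[OF that(2,3)]
    show "E p t" by (rule alive_adj_p[OF tD])
    have "E c t" using that(2) unfolding K_def by blast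
    then show "distinct [p, u, t, leaf t]"
      using that irr leaf(2,4,5)[OF tD] by auto
    show "E t (leaf t)" "leaf t \<in> F" using leaf[OF tD] XF by blast+
  qed (use that in auto)
  have deep: False if s: "s \<in> S" "s \<in> K c" "s \<noteq> p" and t: "t \<in> T" "t \<in> K c" "t \<noteq> p" for s t
  proof (cases "s = t")
    case True
    have sc: "s \<noteq> c" using s(1) ST(2) F(3) by blast
    note sD = KD[OF s(2,3)]
    show False
    proof (rule no_path4[OF sm, of c ?l s "leaf s"])
      show "distinct [c, ?l, s, leaf s]"
        using leaf_inj[OF sD c sc] l(4,5) leaf(4,5)[OF sD] sD cV sc by auto
      show "E c s" using s(2) unfolding K_def by blast
    qed (use s t True ST leaf[OF sD] l F cV in auto)
  next
    case False
    have "s \<in> F" "t \<in> F" using s t ST by blast+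
    then show False using two_branches_contra[OF c F(2,1) XF _ s(2) KD[OF s(2,3)] _ t(2) KD[OF t(2,3)] False] by blast
  qed
  have SF: "x \<in> F" if "x \<in> S \<or> x \<in> T" for x using that ST by blast
  have S2: "p \<in> S" "\<exists>u \<in> S. E p u \<and> u \<notin> X \<and> \<not> E c u \<and> u \<noteq> c"
    and T2: "p \<in> T" "\<exists>u \<in> T. E p u \<and> u \<notin> X \<and> \<not> E c u \<and> u \<noteq> c"
    using step[OF ST(1,2,5)] step[OF ST(3,4,6)] deep mixed SF by meson+
  obtain s where s: "s \<in> S" "E p s" "s \<notin> X" "\<not> E c s" "s \<noteq> c" using S2(2) by blast
  obtain t where t: "t \<in> T" "E p t" "t \<notin> X" "\<not> E c t" "t \<noteq> c" using T2(2) by blast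
  have sF: "s \<in> F" "t \<in> F" "p \<in> F" using s t S2 ST by blast+
  have st: "s \<noteq> t"
  proof
    assume e: "s = t"
    have "s \<noteq> p" "s \<noteq> ?l" using s irr l(1) by blast+
    then show False
      by (intro no_path4[OF sm, of c ?l p s]) (use s t e ST S2(1) T2(1) l cp F cV in auto)
  qed
  have only: False if "u \<in> F" "w \<in> F" "E p u" "E p w" "u \<notin> X" "w \<notin> X" "u \<noteq> w" "z \<in> X" "E u z" for u w z
    by (rule no_path4[OF F(2,1), of p w u z]) (use that sF(3) irr p XF in auto)
  have nD: "u \<notin> D" if "u \<in> F" "w \<in> F" "E p u" "E p w" "u \<notin> X" "w \<notin> X" "u \<noteq> w" for u w
    using only[OF that, of "leaf u"] leaf[of u] that(5) by blast
  have "twins s t" unfolding twins_def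
    using only[OF sF(1,2) s(2) t(2) s(3) t(3) st] only[OF sF(2,1) t(2) s(2) t(3) s(3) st[symmetric]]
      nD[OF sF(1,2) s(2) t(2) s(3) t(3) st] nD[OF sF(2,1) t(2) s(2) t(3) s(3) st[symmetric]]
      s t st sF F(1) by blast
  then show ?thesis by blast
qed

text \<open>A neighbour of \<open>s\<close> or \<open>t\<close> outside the triangle cannot be in
  \<open>X\<close>, so it is alive and itself not simplicial; this lengthens the arm by its second
  edge.\<close>

lemma twins_induced_T3:
  assumes c: "c \<in> D - X" and tw: "twins s t"
  shows "\<exists>f :: nat \<Rightarrow> 'a. inj_on f {1..9} \<and> f ` {1..9} \<subseteq> V \<and>
     (\<forall>i \<in> {1..9}. \<forall>j \<in> {1..9}. E (f i) (f j) \<longleftrightarrow> (i, j) \<in> T3_edges \<union> T3_edges\<inverse>)"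
proof -
  have st: "s \<noteq> t" "E p s" "E p t" "s \<in> V - X" "t \<in> V - X" "s \<notin> D" "t \<notin> D"
    and only: "\<And>z. z \<in> X \<Longrightarrow> E s z \<Longrightarrow> z = p" "\<And>z. z \<in> X \<Longrightarrow> E t z \<Longrightarrow> z = p"
    using tw unfolding twins_def by blast+
  have root: "conn E (V - {p}) r u" if "E p u" "u \<in> V" "u \<notin> D" for u
    using conn_step[OF rp that(1,2)] that irr unfolding D_iff by blast
  have "conn E (V - {p}) s t"
    using conn_trans[OF cs[OF root[OF st(2)]] root[OF st(3)]] st by blast
  then have E_st: "E s t" by (rule block[OF pV st(2,3,1)])
  have tail: "\<exists>b d. b \<in> V \<and> d \<in> V \<and> E u b \<and> b \<noteq> p \<and> \<not> E b p \<and> E b d \<and> d \<noteq> u \<and> \<not> E d u"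
    if u: "u \<in> V - X" "E p u" "\<And>z. z \<in> X \<Longrightarrow> E u z \<Longrightarrow> z = p" for u
  proof -
    have uV: "u \<in> V" using u(1) by blast
    obtain b where b: "b \<in> V" "E u b" "b \<noteq> p" "\<not> E b p"
      using nonneighbour_of[OF uV not_simplicial[OF u(1)] sym[OF u(2)] pV] .
    have bX: "b \<in> V - X" using b u(3) by blast
    obtain d where "d \<in> V" "E b d" "d \<noteq> u" "\<not> E d u"
      using nonneighbour_of[OF b(1) not_simplicial[OF bX] sym[OF b(2)] uV] .
    then show ?thesis using b by blast
  qed
  obtain b b' where b: "b \<in> V" "b' \<in> V" "E s b" "b \<noteq> p" "\<not> E b p" "E b b'" "b' \<noteq> s" "\<not> E b' s"
    using tail[OF st(4,2) only(1)] by blast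
  obtain d d' where d: "d \<in> V" "d' \<in> V" "E t d" "d \<noteq> p" "\<not> E d p" "E d d'" "d' \<noteq> t" "\<not> E d' t"
    using tail[OF st(5,3) only(2)] by blast
  have cD: "c \<in> D" using c by blast
  have "s \<noteq> p" using st(2) irr by blast
  then have ncs: "\<not> E c s" "c \<noteq> s" using D_step[OF cD, of s] st(4,6) cD by blast+
  show ?thesis
    using induced_T3[of p s t c "leaf c" b b' d d'] pV st leaf[OF c] alive_adj_p[OF c] DV[OF cD] b d ncs E_st
    by simp
qed

text \<open>Four cases exhaust the possibilities: some \<open>K c\<close> meets \<open>X\<close>;
  none does, and \<open>p\<close> has a neighbour in \<open>X\<close>; it has none, and some alive
  \<open>d\<close> in \<open>D\<close> can be added to \<open>X\<close> together with
  \<open>p\<close>; no such \<open>d\<close> can.\<close>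

lemma good_or_twins:
  assumes "D - X \<noteq> {}"
  shows "(\<exists>c \<in> D - X. good c) \<or> (\<exists>s t. twins s t)"
proof (rule ccontr)
  assume "\<not> ?thesis"
  then have ng: "\<And>c. c \<in> D - X \<Longrightarrow> \<not> good c" and nt: "\<not> (\<exists>s t. twins s t)" by blast+
  obtain c where c: "c \<in> D - X" using assms by blast
  have K: "K c \<inter> X = {}" if "c \<in> D - X" for c
    using X_neighbour_twins[OF that _ _ ng[OF that]] nt by blast
  have "p \<in> K c" using sym[OF alive_adj_p[OF c]] pV unfolding K_def by blast
  then have p: "p \<notin> X" using K[OF c] by blast
  have no_X: "\<not> E p z" if "z \<in> X" for z
    using X_pendant_good[OF c K[OF c] p that] ng[OF c] by blast
  have "\<not> small E (insert d (insert p X))" if "d \<in> D - X" for d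
    using extendable_twins[OF that K[OF that] p no_X _ ng[OF that]] nt by blast
  then show False using blocked_good[OF c K[OF c] p] ng[OF c] by blast
qed

end

section \<open>Choice of the root and of the branch point\<close>

context face_extension
begin

lemma ex_good:
  assumes ne: "V - X \<noteq> {}"
    and T3_free: "\<not> (\<exists>f :: nat \<Rightarrow> 'a. inj_on f {1..9} \<and> f ` {1..9} \<subseteq> V \<and>
     (\<forall>i \<in> {1..9}. \<forall>j \<in> {1..9}. E (f i) (f j) \<longleftrightarrow> (i, j) \<in> T3_edges \<union> T3_edges\<inverse>))"
  shows "\<exists>v \<in> V - X. good v"
proof (rule ccontr)
  assume ng: "\<not> ?thesis"
  then have ns: "\<not> simplicial v" if "v \<in> V - X" for v using simplicial_good that by blast
  obtain r where r: "r \<in> V - X" using ne by blast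
  then have rr: "conn E V r r" by (blast intro: conn_refl)
  let ?P = "\<lambda>q. conn E V r q \<and> (\<exists>c \<in> V - X. c \<in> desc r q \<and> c \<noteq> q)"
  obtain c where c: "conn E V r c" "c \<noteq> r" "c \<notin> X" using isolated_good[OF r] ng r by blast
  have "c \<in> V" using c(1) by (rule conn_in(2))
  moreover have "\<not> conn E (V - {r}) r c" using conn_in(1)[of E "V - {r}" r c] by blast
  \<comment> \<open>The root qualifies as a branch point: by \<open>isolated_good\<close> its
    component contains a second alive vertex.\<close>
  ultimately have "?P r" using c rr unfolding desc_def by blast
  \<comment> \<open>Lowest means that \<open>desc r p\<close> has least size, so that no tree of
    blocks has to be built.\<close>
  from ex_has_least_nat[of ?P, OF this, of "\<lambda>q. card (desc r q)"]
  obtain p where p: "?P p" "\<forall>q. ?P q \<longrightarrow> card (desc r p) \<le> card (desc r q)" by (elim exE conjE) simp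
  interpret branch_point E V X r p
  proof
    show "conn E V r p" using p(1) by blast
    show "c = q" if "conn E V r q" "card (desc r q) < card (desc r p)" "c \<in> V - X" "c \<in> desc r q" for q c
    proof (rule ccontr)
      assume "c \<noteq> q"
      then have "?P q" using that by blast
      then show False using p(2)[THEN spec[of _ q]] that(2) by simp
    qed
    show "\<not> simplicial v" if "v \<in> V - X" for v using ns[OF that] .
  qed
  obtain c where c: "c \<in> D - X" using p(1) unfolding D_def by blast
  then have "D - X \<noteq> {}" by blast
  from good_or_twins[OF this] obtain s t where "twins s t" using ng DV by blast
  then show False using twins_induced_T3[OF c] T3_free by blast
qed

end

section \<open>Adjacency relations of finite simple graphs\<close>

context graph
begin

abbreviation adj :: "'a \<Rightarrow> 'a \<Rightarrow> bool" where
  "adj a b \<equiv> (a, b) \<in> arcs_ends G"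

lemma adj_sym: "adj a b \<Longrightarrow> adj b a"
  using sym_arcs unfolding symmetric_def sym_def by blast

lemma adj_irrefl: "\<not> adj a a"
  using no_loops by (auto simp: arcs_ends_conv)

lemma arcs_ends_induce: "arcs_ends (G \<restriction> A) = {(a, b). adj a b \<and> a \<in> A \<and> b \<in> A}"
  by (auto simp: arcs_ends_conv)

lemma conn_iff_reachable:
  assumes "A \<subseteq> verts G"
  shows "conn adj A a b \<longleftrightarrow> a \<rightarrow>\<^sup>*\<^bsub>G \<restriction> A\<^esub> b"
proof
  assume "conn adj A a b"
  then show "a \<rightarrow>\<^sup>*\<^bsub>G \<restriction> A\<^esub> b"
    unfolding reachable_def
  proof induction
    case conn_refl
    then show ?case by simp
  next
    case (conn_step b c)
    have "b \<in> A" using conn_in(2)[OF conn_step.hyps(1)] .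
    then show ?case using conn_step
      by (intro rtrancl_on_into_rtrancl_on[OF conn_step.IH]) (auto simp: arcs_ends_induce)
  qed
next
  assume "a \<rightarrow>\<^sup>*\<^bsub>G \<restriction> A\<^esub> b"
  then show "conn adj A a b"
    unfolding reachable_def
    by (induction rule: rtrancl_on_induct) (auto simp: arcs_ends_induce intro: conn.intros)
qed

lemma graph_induce:
  assumes "A \<subseteq> verts G"
  shows "graph (G \<restriction> A)"
proof -
  have ind: "induced_subgraph (G \<restriction> A) G" using assms by (rule induced_induce)
  then have s: "symmetric (G \<restriction> A)" using sym_arcs induced_graph_imp_symmetric by blast
  have wf: "wf_digraph (G \<restriction> A)" by (rule wellformed_induce_subgraph)
  have d: "digraph (G \<restriction> A)" using ind by (intro digraph_subgraph) blast
  then have "fin_digraph (G \<restriction> A)" by (simp add: digraph_def)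
  with d s wf show ?thesis
    by (simp add: graph_def pseudo_graph_def sym_digraph_def sym_digraph_axioms_def)
qed

lemma r_independent_iff_small: "r_independent 3 G A \<longleftrightarrow> A \<subseteq> verts G \<and> small adj A"
proof (cases "A \<subseteq> verts G")
  case True
  interpret A: graph "G \<restriction> A" by (rule graph_induce[OF True])
  have fA: "finite A" using True finite_verts finite_subset by blast
  have comp: "{v. a \<rightarrow>\<^sup>*\<^bsub>G \<restriction> A\<^esub> v} = {v. conn adj A a v}" for a
    using conn_iff_reachable[OF True] by blast
  have "(\<forall>C \<in> pre_digraph.sccs (G \<restriction> A). card (verts C) \<le> 3) \<longleftrightarrow> small adj A"
  proof
    assume small: "\<forall>C \<in> pre_digraph.sccs (G \<restriction> A). card (verts C) \<le> 3"
    show "small adj A" unfolding small_def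
    proof
      fix a assume "a \<in> A"
      then have "a \<in> verts (G \<restriction> A)" by simp
      from bspec[OF small A.induce_reachable_is_in_sccs[OF this]]
      show "card {b. conn adj A a b} \<le> 3" by (simp add: comp)
    qed
  next
    assume small: "small adj A"
    show "\<forall>C \<in> pre_digraph.sccs (G \<restriction> A). card (verts C) \<le> 3"
    proof
      fix C assume "C \<in> pre_digraph.sccs (G \<restriction> A)"
      then have sc: "strongly_connected C" and iC: "induced_subgraph C (G \<restriction> A)"
        by (auto simp: pre_digraph.sccs_def)
      obtain u where u: "u \<in> verts C" using sc by (auto simp: strongly_connected_def)
      have sCA: "subgraph C (G \<restriction> A)" using iC by blast
      then have uA: "u \<in> A" using u by (auto simp: subgraph_def)
      have "verts C \<subseteq> {v. u \<rightarrow>\<^sup>*\<^bsub>G \<restriction> A\<^esub> v}"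
      proof
        fix v assume "v \<in> verts C"
        then have "u \<rightarrow>\<^sup>*\<^bsub>C\<^esub> v" using sc u by (auto simp: strongly_connected_def)
        then show "v \<in> {v. u \<rightarrow>\<^sup>*\<^bsub>G \<restriction> A\<^esub> v}" using A.reachable_mono[OF _ sCA] by auto
      qed
      then have "card (verts C) \<le> card {v. conn adj A u v}"
        unfolding comp by (rule card_mono[OF finite_comp[OF fA]])
      also have "\<dots> \<le> 3" using small uA unfolding small_def by blast
      finally show "card (verts C) \<le> 3" .
    qed
  qed
  then show ?thesis using True unfolding r_independent_def by blast
qed (simp add: r_independent_def)

section \<open>From complete blocks to the block condition on adjacency\<close>

lemma connected_induce:
  assumes "A \<subseteq> verts G"
  shows "connected (G \<restriction> A) \<longleftrightarrow> A \<noteq> {} \<and> (\<forall>a \<in> A. \<forall>b \<in> A. conn adj A a b)"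
proof -
  interpret A: graph "G \<restriction> A" by (rule graph_induce[OF assms])
  have "(arcs_ends (G \<restriction> A))\<^sup>s = arcs_ends (G \<restriction> A)"
    by (auto simp: arcs_ends_induce symcl_def intro: adj_sym)
  then show ?thesis
    unfolding connected_conv by (simp add: conn_iff_reachable[OF assms] reachable_def)
qed

lemma del_vert_induce: "pre_digraph.del_vert (G \<restriction> A) v = G \<restriction> (A - {v})"
  by (auto simp: pre_digraph.del_vert_def induce_subgraph_def)

text \<open>Blocks are maximal among all subgraphs, not only the induced ones. The measure therefore
  counts arcs as well as vertices: inclusion without growth of this sum is equality.\<close>

lemma subgraph_of_block:
  assumes H: "subgraph H G" "nonseparable H"
  obtains B where "B \<in> blocks G" "subgraph H B"
proof -
  let ?P = "\<lambda>B. subgraph B G \<and> nonseparable B \<and> subgraph H B"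
  let ?m = "\<lambda>B :: ('a, 'b) pre_digraph. card (verts B) + card (arcs B)"
  have "subgraph H H" using H(1) by (auto simp: subgraph_def compatible_def)
  then have "?P H" using H by blast
  moreover have "?m B < Suc (card (verts G) + card (arcs G))" if "?P B" for B
  proof -
    have "verts B \<subseteq> verts G" "arcs B \<subseteq> arcs G" using that by (auto simp: subgraph_def)
    then have "card (verts B) \<le> card (verts G)" "card (arcs B) \<le> card (arcs G)"
      by (auto intro: card_mono)
    then show ?thesis by simp
  qed
  ultimately obtain B where B: "?P B" "\<forall>B'. ?P B' \<longrightarrow> ?m B' \<le> ?m B"
    using ex_has_greatest_nat[of ?P H ?m "Suc (card (verts G) + card (arcs G))"] by blast
  have "B' = B" if B': "subgraph B B'" "subgraph B' G" "nonseparable B'" for B'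
  proof -
    have "subgraph H B'" using B(1) B'(1) subgraph_trans by blast
    then have le: "?m B' \<le> ?m B" using B(2) B' by blast
    have sub: "verts B \<subseteq> verts B'" "arcs B \<subseteq> arcs B'" "verts B' \<subseteq> verts G" "arcs B' \<subseteq> arcs G"
      using B' by (auto simp: subgraph_def)
    have fin: "finite (verts B')" "finite (arcs B')"
      using sub finite_subset finite_verts finite_arcs by (metis, metis)
    have "card (verts B) \<le> card (verts B')" "card (arcs B) \<le> card (arcs B')"
      using sub fin by (auto intro: card_mono)
    then have "verts B' = verts B" "arcs B' = arcs B"
      using le card_seteq[OF fin(1) sub(1)] card_seteq[OF fin(2) sub(2)] by auto
    moreover have "tail B' = tail B" "head B' = head B"
      using B'(1) by (auto simp: subgraph_def compatible_def)
    ultimately show ?thesis by simp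
  qed
  then have "B \<in> blocks G" using B(1) unfolding blocks_def max_subgraph_def by blast
  then show thesis using B(1) that by blast
qed

text \<open>A component of \<open>W - {w}\<close> that contains neither \<open>a\<close> nor \<open>b\<close> could be removed from \<open>W\<close>, against
  its minimality. So each vertex of \<open>W - {w}\<close> is connected to \<open>a\<close> or \<open>b\<close>, hence to \<open>v\<close>.\<close>

lemma nonseparable_through_hub:
  assumes v: "v \<in> verts G" and ab: "adj v a" "adj v b" "a \<noteq> b" and W: "W \<subseteq> verts G - {v}" "conn adj W a b"
    and min: "\<And>W'. W' \<subset> W \<Longrightarrow> \<not> conn adj W' a b"
  shows "nonseparable (G \<restriction> insert v W)"
proof -
  have abW: "a \<in> W" "b \<in> W" using conn_in[OF W(2)] by auto
  have sub: "insert v W \<subseteq> verts G" using v W(1) by blast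
  have cs: "conn adj A y x" if "conn adj A x y" for A x y
    by (rule conn_sym[where E = adj, OF _ that]) (rule adj_sym)
  have ends: "conn adj (W - {w}) x a \<or> conn adj (W - {w}) x b" if w: "w \<in> W" and x: "x \<in> W - {w}" for w x
  proof (rule ccontr)
    assume n: "\<not> ?thesis"
    let ?C = "{y. conn adj (W - {w}) x y}"
    have xC: "x \<in> ?C" using x conn_refl[of x "W - {w}" adj] by simp
    have out: "a \<notin> ?C" "b \<notin> ?C" using n by auto
    have wC: "w \<notin> ?C" using conn_in(2)[of adj "W - {w}" x w] by blast
    have cross: "u = w" if "u \<notin> ?C" "y \<in> ?C" "adj y u" "u \<in> W" for u y
    proof (rule ccontr)
      assume "u \<noteq> w"
      then have "conn adj (W - {w}) x u" using conn_step[of adj "W - {w}" x y u] that by blast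
      then show False using that(1) by blast
    qed
    \<comment> \<open>A walk can enter and leave \<open>?C\<close> only at \<open>w\<close>, so its
      excursions into \<open>?C\<close> can be cut out. During an excursion the shortened walk waits
      at \<open>w\<close>.\<close>
    have "(y \<notin> ?C \<longrightarrow> conn adj (W - ?C) a y) \<and> (y \<in> ?C \<longrightarrow> conn adj (W - ?C) a w)" if "conn adj W a y" for y
      using that
    proof induction
      case conn_refl
      then show ?case using out conn.conn_refl[of a "W - ?C" adj] by blast
    next
      case (conn_step y z)
      have y: "y \<in> W" using conn_in(2)[OF conn_step.hyps(1)] .
      consider "y \<in> ?C" "z \<in> ?C" | "y \<in> ?C" "z \<notin> ?C" | "y \<notin> ?C" "z \<in> ?C" | "y \<notin> ?C" "z \<notin> ?C" by blast
      then show ?case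
      proof cases
        case 1
        then show ?thesis using conn_step.IH by blast
      next
        case 2
        then have "z = w" using cross conn_step.hyps by blast
        then show ?thesis using 2 conn_step.IH by blast
      next
        case 3
        then have "y = w" using cross[OF 3 adj_sym[OF conn_step.hyps(2)] y] by blast
        then show ?thesis using 3 conn_step.IH by blast
      next
        case 4
        then have "conn adj (W - ?C) a y" using conn_step.IH by blast
        then have "conn adj (W - ?C) a z"
          by (rule conn.conn_step) (use 4 conn_step.hyps in auto)
        then show ?thesis using 4 by blast
      qed
    qed
    then have "conn adj (W - ?C) a b" using W(2) out by blast
    moreover have "W - ?C \<subset> W" using xC x by blast
    ultimately show False using min by blast
  qed
  have whole: "conn adj W a x" if x: "x \<in> W" for x
  proof (rule ccontr)
    assume n: "\<not> conn adj W a x"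
    let ?C = "{y. conn adj W a y}"
    have "conn adj ?C a y" if "conn adj W a y" for y
      using that
    proof induction
      case conn_refl
      then show ?case using conn.conn_refl[of a W adj] by (intro conn.conn_refl) blast
    next
      case (conn_step y z)
      have "conn adj W a z" using conn_step.hyps by (rule conn.conn_step)
      then show ?case using conn.conn_step[OF conn_step.IH conn_step.hyps(2)] by blast
    qed
    then have "conn adj ?C a b" using W(2) by blast
    moreover have "?C \<subset> W"
    proof -
      have "?C \<subseteq> W" by (auto dest: conn_in(2))
      then show ?thesis using n x by blast
    qed
    ultimately show False using min by blast
  qed
  have from_hub: "connected (G \<restriction> A)" if A: "A \<subseteq> verts G" "h \<in> A" "\<And>x. x \<in> A \<Longrightarrow> conn adj A h x" for A h
    unfolding connected_induce[OF A(1)]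
    using A(2) conn_trans[OF cs[OF A(3)] A(3)] by blast
  have av: "adj a v" "adj b v" using ab adj_sym by blast+
  have avne: "a \<noteq> v" "b \<noteq> v" using abW W(1) by blast+
  have "connected (G \<restriction> (insert v W))"
  proof (rule from_hub[OF sub, of a])
    fix x assume x: "x \<in> insert v W"
    show "conn adj (insert v W) a x"
    proof (cases "x = v")
      case True
      then show ?thesis using conn_edge[of adj a v "insert v W"] av abW by blast
    next
      case False
      then have "conn adj W a x" using whole x by blast
      then show ?thesis by (rule conn_mono) blast
    qed
  qed (use abW in blast)
  moreover have "connected (G \<restriction> (insert v W - {w}))" if w: "w \<in> insert v W" for w
  proof (cases "w = v")
    case True
    then have e: "insert v W - {w} = W" using W(1) by blast
    show ?thesis unfolding e by (rule from_hub[of W a]) (use W abW whole in blast)+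
  next
    case False
    let ?A = "insert v W - {w}"
    have wW: "w \<in> W" using w False by blast
    have AV: "?A \<subseteq> verts G" using sub by blast
    have vA: "v \<in> ?A" using False by blast
    show ?thesis
    proof (rule from_hub[OF AV vA])
      fix x assume x: "x \<in> ?A"
      show "conn adj ?A v x"
      proof (cases "x = v")
        case True
        then show ?thesis using conn_refl[OF vA] by blast
      next
        case xv: False
        then have "x \<in> W - {w}" using x by blast
        then obtain e where e: "e = a \<or> e = b" "conn adj (W - {w}) x e" using ends[OF wW] by blast
        have xe: "conn adj ?A e x" by (rule conn_mono[OF cs[OF e(2)]]) blast
        have "adj v e" using e(1) ab by blast
        then have "conn adj ?A v e" using vA conn_in(1)[OF xe] by (rule conn_edge)
        then show ?thesis using xe by (rule conn_trans)
      qed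
    qed
  qed
  ultimately show ?thesis
    unfolding nonseparable_def using graph_induce[OF sub] by (simp add: del_vert_induce)
qed

text \<open>A minimal \<open>W\<close> connecting \<open>a\<close> to \<open>b\<close> away from
  \<open>v\<close> is in effect an induced path. Together with \<open>v\<close> it closes to a cycle
  and spans a nonseparable subgraph, which lies in a block, and blocks are complete.\<close>

lemma block_graph_adj:
  assumes BG: "block_graph G" and v: "v \<in> verts G" and ab: "adj v a" "adj v b" "a \<noteq> b"
    and c: "conn adj (verts G - {v}) a b"
  shows "adj a b"
proof -
  let ?S = "{W. W \<subseteq> verts G - {v} \<and> conn adj W a b}"
  have "finite ?S" by (rule finite_subset[of _ "Pow (verts G)"]) auto
  moreover have "verts G - {v} \<in> ?S" using c by blast
  ultimately obtain W where W: "W \<in> ?S" "\<forall>W' \<in> ?S. W' \<subseteq> W \<longrightarrow> W = W'"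
    using finite_has_minimal2[of ?S "verts G - {v}"] by blast
  have min: "\<not> conn adj W' a b" if "W' \<subset> W" for W'
    using W that by blast
  have WV: "W \<subseteq> verts G - {v}" "conn adj W a b" using W(1) by blast+
  have ns: "nonseparable (G \<restriction> insert v W)"
    by (rule nonseparable_through_hub[OF v ab WV min])
  have "insert v W \<subseteq> verts G" using v WV(1) by blast
  then have "subgraph (G \<restriction> insert v W) G" using induced_induce by blast
  then obtain B where B: "B \<in> blocks G" "subgraph (G \<restriction> insert v W) B"
    using ns by (rule subgraph_of_block)
  have BG': "subgraph B G" using B(1) unfolding blocks_def max_subgraph_def by blast
  have "W \<subseteq> verts B" using B(2) by (auto simp: subgraph_def)
  then have "a \<in> verts B" "b \<in> verts B" using conn_in[OF WV(2)] by blast+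
  moreover have "complete_digraph (card (verts B)) B"
    using BG B(1) unfolding block_graph_def by blast
  ultimately have "(a, b) \<in> arcs_ends B" using ab(3) unfolding complete_digraph_def by simp
  then show ?thesis using arcs_ends_mono[OF BG'] by blast
qed

section \<open>The forbidden subgraph and the conclusion\<close>

lemma induced_T3_not_free:
  fixes f :: "nat \<Rightarrow> 'a"
  assumes f: "inj_on f {1..9}" "f ` {1..9} \<subseteq> verts G"
    and e: "\<And>i j. i \<in> {1..9} \<Longrightarrow> j \<in> {1..9} \<Longrightarrow> adj (f i) (f j) \<longleftrightarrow> (i, j) \<in> T3_edges \<union> T3_edges\<inverse>"
  shows "\<not> induced_free T3 G"
proof -
  let ?H = "G \<restriction> (f ` {1..9})"
  define g where "g = the_inv_into {1..9} f"
  have gf: "g (f i) = i" if "i \<in> {1..9}" for i unfolding g_def by (rule the_inv_into_f_f[OF f(1) that])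
  interpret H: graph ?H by (rule graph_induce[OF f(2)])
  \<comment> \<open>The arcs of \<open>T3\<close> are pairs of vertices, so an arc of
    \<open>G\<close> has to go to the relabelled pair of its ends; absence of parallel arcs makes
    this injective.\<close>
  define h :: "('a, 'b, nat, nat \<times> nat) digraph_isomorphism" where
    "h = \<lparr>iso_verts = g, iso_arcs = (\<lambda>e. (g (tail G e), g (head G e))), iso_head = snd, iso_tail = fst\<rparr>"
  have inj: "inj_on g (f ` {1..9})" by (rule inj_onI) (use gf in force)
  have iso: "H.digraph_isomorphism h"
    unfolding H.digraph_isomorphism_def
  proof (intro conjI)
    show "inj_on (iso_arcs h) (arcs ?H)"
    proof (rule inj_onI)
      fix x y assume xy: "x \<in> arcs ?H" "y \<in> arcs ?H" "iso_arcs h x = iso_arcs h y"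
      then have "tail G x = tail G y" "head G x = head G y"
        using inj unfolding h_def by (auto dest: inj_onD)
      then show "x = y" using xy(1,2) by (intro no_multi_arcs) (auto simp: arc_to_ends_def)
    qed
  qed (use inj in \<open>auto simp: h_def intro: H.wf_digraph\<close>)
  have T3sub: "T3_edges \<union> T3_edges\<inverse> \<subseteq> {1..9} \<times> {1..9}" unfolding T3_edges_def by auto
  have im: "g ` f ` {1..9} = {1..9}" using gf by force
  have "iso_arcs h ` arcs ?H = (\<lambda>(a, b). (g a, g b)) ` arcs_ends ?H"
    unfolding arcs_ends_conv h_def by force
  also have "\<dots> = T3_edges \<union> T3_edges\<inverse>" (is "?L = ?R")
  proof
    show "?L \<subseteq> ?R"
    proof
      fix x assume "x \<in> ?L"
      then obtain a b where ab: "adj a b" "a \<in> f ` {1..9}" "b \<in> f ` {1..9}" "x = (g a, g b)"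
        by (auto simp: arcs_ends_induce)
      obtain i where i: "i \<in> {1..9}" "a = f i" using ab(2) by (rule imageE)
      obtain j where j: "j \<in> {1..9}" "b = f j" using ab(3) by (rule imageE)
      then show "x \<in> ?R" using e[OF i(1) j(1)] gf[OF i(1)] gf[OF j(1)] ab i(2) j(2) by simp
    qed
    show "?R \<subseteq> ?L"
    proof
      fix x assume x: "x \<in> ?R"
      obtain i j where ij: "x = (i, j)" by (cases x)
      have m: "i \<in> {1..9}" "j \<in> {1..9}" using x T3sub unfolding ij by blast+
      then have "adj (f i) (f j)" using e x unfolding ij by blast
      then have "(f i, f j) \<in> arcs_ends ?H" using m unfolding arcs_ends_induce by blast
      then have "(\<lambda>(a, b). (g a, g b)) (f i, f j) \<in> ?L" by (rule imageI)
      then show "x \<in> ?L" using gf m ij by simp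
    qed
  qed
  finally have arcs: "iso_arcs h ` arcs ?H = T3_edges \<union> T3_edges\<inverse>" .
  have "app_iso h ?H = with_proj T3"
    using im arcs by (intro pre_digraph.equality) (simp_all add: T3_def h_def)
  then have "digraph_iso ?H T3" unfolding digraph_iso_def using iso by metis
  then show ?thesis unfolding induced_free_def using induced_induce[OF f(2)] by blast
qed

lemma shellable_Ind3:
  assumes BG: "block_graph G" and free: "induced_free T3 G"
  shows "shellable (Ind 3 G)"
proof (rule shellable_if_exchange_vertices[OF simplicial_complex_on_Ind finite_verts])
  fix X assume X: "X \<in> Ind 3 G" "X \<notin> facets (Ind 3 G)"
  let ?K = "Ind 3 G"
  have K: "A \<in> ?K \<longleftrightarrow> A \<subseteq> verts G \<and> small adj A" for A
    unfolding Ind_def using r_independent_iff_small by simp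
  have down: "\<And>A B. A \<in> ?K \<Longrightarrow> B \<subseteq> A \<Longrightarrow> B \<in> ?K"
    using simplicial_complex_on_Ind[of 3] unfolding simplicial_complex_on_def by blast
  \<comment> \<open>\<open>V\<close> is the union of the faces above \<open>X\<close>. Shrinking the
    vertex set to it keeps \<open>block\<close> and creates no induced copy of
    \<open>T3\<close>.\<close>
  define V where "V = X \<union> {u. insert u X \<in> ?K}"
  have "u \<in> verts G" if "insert u X \<in> ?K" for u using that K[of "insert u X"] by simp
  then have VG: "V \<subseteq> verts G" using X(1) K[of X] unfolding V_def by auto
  interpret face_extension adj V X
  proof
    show "finite V" by (rule finite_subset[OF VG finite_verts])
    show "adj b a" if "adj a b" for a b using adj_sym[OF that] .
    show "\<not> adj a a" for a by (rule adj_irrefl)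
    show "adj a b" if "v \<in> V" "adj v a" "adj v b" "a \<noteq> b" "conn adj (V - {v}) a b" for v a b
    proof (rule block_graph_adj[OF BG _ that(2-4)])
      show "v \<in> verts G" using that(1) VG by blast
      show "conn adj (verts G - {v}) a b" by (rule conn_mono[OF that(5)]) (use VG in blast)
    qed
    show "X \<subseteq> V" unfolding V_def by blast
    show "small adj (insert v X)" if "v \<in> V - X" for v using that K unfolding V_def by blast
  qed
  obtain Y where Y: "Y \<in> ?K" "X \<subset> Y" using X unfolding facets_def by blast
  then obtain u where u: "u \<in> Y" "u \<notin> X" by blast
  then have "insert u X \<in> ?K" using down[OF Y(1)] Y(2) by blast
  then have "V - X \<noteq> {}" using u(2) unfolding V_def by blast
  moreover have "\<not> (\<exists>f :: nat \<Rightarrow> 'a. inj_on f {1..9} \<and> f ` {1..9} \<subseteq> V \<and>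
     (\<forall>i \<in> {1..9}. \<forall>j \<in> {1..9}. adj (f i) (f j) \<longleftrightarrow> (i, j) \<in> T3_edges \<union> T3_edges\<inverse>))"
  proof
    assume "\<exists>f :: nat \<Rightarrow> 'a. inj_on f {1..9} \<and> f ` {1..9} \<subseteq> V \<and>
     (\<forall>i \<in> {1..9}. \<forall>j \<in> {1..9}. adj (f i) (f j) \<longleftrightarrow> (i, j) \<in> T3_edges \<union> T3_edges\<inverse>)"
    then obtain f :: "nat \<Rightarrow> 'a" where f: "inj_on f {1..9}" "f ` {1..9} \<subseteq> V"
      "\<forall>i \<in> {1..9}. \<forall>j \<in> {1..9}. adj (f i) (f j) \<longleftrightarrow> (i, j) \<in> T3_edges \<union> T3_edges\<inverse>" by (elim exE conjE)
    have "\<not> induced_free T3 G"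
    proof (rule induced_T3_not_free[OF f(1)])
      show "f ` {1..9} \<subseteq> verts G" using f(2) VG by (rule subset_trans)
      show "adj (f i) (f j) \<longleftrightarrow> (i, j) \<in> T3_edges \<union> T3_edges\<inverse>" if "i \<in> {1..9}" "j \<in> {1..9}" for i j
        by (rule bspec[OF bspec[OF f(3) that(1)] that(2)])
    qed
    then show False using free by blast
  qed
  ultimately obtain v where v: "v \<in> V - X" "good v" using ex_good by blast
  have FV: "F \<subseteq> V" if "F \<in> ?K" "X \<subseteq> F" for F
  proof
    fix u assume "u \<in> F"
    then have "insert u X \<in> ?K" using down[OF that(1)] that(2) by blast
    then show "u \<in> V" unfolding V_def by blast
  qed
  have "exchange_vertex ?K X v"
    unfolding exchange_vertex_def
  proof (intro conjI ballI allI impI)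
    show "v \<notin> X" "insert v X \<in> ?K" using v(1) unfolding V_def by blast+
    fix F S T
    assume F: "F \<in> ?K" and
      a: "v \<notin> F \<and> X \<subseteq> S \<and> S \<subseteq> F \<and> X \<subseteq> T \<and> T \<subseteq> F \<and> insert v S \<notin> ?K \<and> insert v T \<notin> ?K"
    have XF: "X \<subseteq> F" using a by blast
    have vG: "insert v S \<subseteq> verts G" "insert v T \<subseteq> verts G" using v(1) VG a F K by blast+
    have "small adj F" using F K by blast
    then have "\<not> small adj (insert v (S \<inter> T))"
      using v(2)[unfolded good_def, THEN spec[of _ F], THEN spec[of _ S], THEN spec[of _ T]]
        FV[OF F XF] a vG K by simp
    then show "insert v (S \<inter> T) \<notin> ?K" using K by blast
  qed
  then show "\<exists>v. exchange_vertex ?K X v" by blast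
qed

end

theorem theorem4p10:
  fixes G :: "('a, 'b) pre_digraph"
  assumes "graph G"
    and "block_graph G"
    and "induced_free T3 G"
  shows "shellable (Ind 3 G)"
proof -
  interpret graph G by fact
  show ?thesis using assms(2,3) by (rule shellable_Ind3)
qed

end
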